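(* Let $1\le p<\infty$ and $\nu\ge1$. Let $w\in A_1\cap RH_\sigma$ (that is, $w^\sigma\in A_1$) for some $\sigma$ with $\nu<\sigma<\infty$. Then for $r\in[-n/p,\,-n\sigma'/(p\nu')]$ (if $\nu=1$, the endpoint $r=0$ is excluded), there exists $s_0>\nu$ such that for $\nu<s\le s_0$ and for any cube $Q$, the continuous embedding $$L^r_p(w,\mathbb R^n)\hookrightarrow L_{p,\,M(w^s\chi_Q)^{1/s}}(\mathbb R^n)$$ holds with a constant depending on $Q$ as $w(Q)^{1/p+r/n}$, i.e. $\|f|L_{p,M(w^s\chi_Q)^{1/s}}(\mathbb R^n)\|\le C\,w(Q)^{1/p+r/n}\|f|L^r_p(w,\mathbb R^n)\|$ with $C$ independent of $Q$ and $f$. Moreover, whenever $r\in[-n/p,\,-n(1/\sigma+1/\nu')/p]$, it also holds (for $s$ in such a range $\nu<s\le s_0$ and any cube $Q$) that $$L^r_p(\lambda,w,\mathbb R^n)\hookrightarrow L_{p,\,M(w^s\chi_Q)^{1/s}}(\mathbb R^n)$$ with a constant depending on $Q$ as $|Q|^{1/p+r/n}$ (in the same sense). As a consequence, under the same respective conditions on $w$ and $r$, there exists some $0<\alpha<n/\nu$ such that $$L^r_p(w,\mathbb R^n)\hookrightarrow L_{p,(1+|x|)^{-\alpha}}(\mathbb R^n),\qquad L^r_p(\lambda,w,\mathbb R^n)\hookrightarrow L_{p,(1+|x|)^{-\alpha}}(\mathbb R^n).$$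
   Context: Cubes in $\mathbb R^n$ have sides parallel to the axes. A weight is a nonnegative locally integrable function; $w(E)=\int_E w$, $|E|$ is Lebesgue measure, $\chi_E$ the characteristic function. $p'$ is the conjugate exponent: $1/p+1/p'=1$, with $1'=\infty$ and $1/\infty=0$ (so for $\nu=1$, $1/\nu'=0$). For $0<p<\infty$, $\|f|L_{p,w}(E)\|=(\int_E|f|^pw)^{1/p}$. $M$ is the Hardy–Littlewood maximal operator, $Mf(x)=\sup_{Q\ni x}|Q|^{-1}\int_Q|f|$. Muckenhoupt class $A_1$: a locally integrable $w>0$ a.e. is in $A_1$ iff there is $c$ with $w(Q)/|Q|\le c\,w(x)$ for a.e. $x\in Q$ and every cube $Q$. Reverse Hölder class: for $1<\sigma<\infty$, $w\in RH_\sigma$ iff there is $c$ with $\big(|Q|^{-1}\int_Q w^\sigma\big)^{1/\sigma}\le c\,|Q|^{-1}\int_Q w$ for all cubes $Q$. Morrey spaces: for $0<p<\infty$, $-n/p\le r<0$ and a weight $w$, the spaces $L^r_p(w,\mathbb R^n)$ and $L^r_p(\lambda,w,\mathbb R^n)$ consist of the (classes of) measurable complex functions $f$ on $\mathbb R^n$ for which, respectively, the following quasinorms are finite (suprema over all cubes; here $\lambda$ is just a label for the second type of space): $$\|f|L^r_p(w,\mathbb R^n)\|=\sup_Q w(Q)^{-(1/p+r/n)}\|f|L_{p,w}(Q)\|,\qquad \|f|L^r_p(\lambda,w,\mathbb R^n)\|=\sup_Q |Q|^{-(1/p+r/n)}\|f|L_{p,w}(Q)\|.$$ $X\hookrightarrow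 Y$ means $X\subset Y$ with $\|f|Y\|\le C\|f|X\|$. *)

theory Defs
  imports "HOL-Analysis.Analysis"
begin

definition is_cube :: "(real ^ 'n) set \<Rightarrow> bool" where
  "is_cube Q \<longleftrightarrow> (\<exists>a b l. 0 < l \<and> (\<forall>i. b $ i - a $ i = l) \<and> Q = cbox a b)"

definition weight :: "(real ^ 'n \<Rightarrow> real) \<Rightarrow> bool" where
  "weight w \<longleftrightarrow> (\<forall>x. 0 \<le> w x) \<and> (\<forall>K. compact K \<longrightarrow> w absolutely_integrable_on K)"

definition wmeasure :: "(real ^ 'n \<Rightarrow> real) \<Rightarrow> (real ^ 'n) set \<Rightarrow> real" where
  "wmeasure w E = (LINT x:E|lebesgue. w x)"

(* Only used for exponents a > 0, where it is the usual power on [0, \<infinity>]. *)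
definition ennreal_powr :: "ennreal \<Rightarrow> real \<Rightarrow> ennreal" where
  "ennreal_powr x a = (if x = \<infinity> then \<infinity> else ennreal (enn2real x powr a))"

definition conj_exponent :: "real \<Rightarrow> ereal" where
  "conj_exponent p = (if p = 1 then \<infinity> else ereal (p / (p - 1)))"

lemma conj_exponent:
  assumes "1 \<le> p"
  shows "1 / ereal p + 1 / conj_exponent p = 1"
  using assms by (auto simp: conj_exponent_def one_ereal_def field_simps)

definition maximal_op :: "(real ^ 'n \<Rightarrow> real) \<Rightarrow> real ^ 'n \<Rightarrow> ennreal" where
  "maximal_op f x = (SUP Q \<in> {Q. is_cube Q \<and> x \<in> Q}.
     (\<integral>\<^sup>+y\<in>Q. ennreal \<bar>f y\<bar> \<partial>lebesgue) / emeasure lebesgue Q)"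

definition Muckenhoupt_A1 :: "(real ^ 'n \<Rightarrow> real) set" where
  "Muckenhoupt_A1 = {w. weight w \<and> (AE x in lebesgue. 0 < w x) \<and>
     (\<exists>c. \<forall>Q. is_cube Q \<longrightarrow>
        (AE x in lebesgue. x \<in> Q \<longrightarrow> wmeasure w Q / measure lebesgue Q \<le> c * w x))}"

text \<open>The integral of \<open>w\<^sup>\<sigma>\<close> is taken in \<open>[0, \<infinity>]\<close>, so its finiteness on cubes is part of
  the condition.\<close>

definition reverse_Holder :: "real \<Rightarrow> (real ^ 'n \<Rightarrow> real) set" where
  "reverse_Holder \<sigma> = {w. weight w \<and>
     (\<exists>c. \<forall>Q. is_cube Q \<longrightarrow>
        ennreal_powr ((\<integral>\<^sup>+x\<in>Q. ennreal (w x powr \<sigma>) \<partial>lebesgue) / emeasure lebesgue Q) (1 / \<sigma>)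
          \<le> ennreal (c * (wmeasure w Q / measure lebesgue Q)))}"

text \<open>A function space is given by its quasinorm with values in \<open>[0, \<infinity>]\<close>; its elements are the
  measurable functions of finite quasinorm (representatives instead of classes). The weight
  of a weighted Lebesgue space takes values in \<open>[0, \<infinity>]\<close>, as maximal functions do.\<close>

definition Lp_norm ::
  "real \<Rightarrow> (real ^ 'n \<Rightarrow> ennreal) \<Rightarrow> (real ^ 'n) set \<Rightarrow> (real ^ 'n \<Rightarrow> complex) \<Rightarrow> ennreal" where
  "Lp_norm p W E f =
     ennreal_powr (\<integral>\<^sup>+x\<in>E. (ennreal (cmod (f x) powr p) * W x) \<partial>lebesgue) (1 / p)"

definition Morrey_norm ::
  "real \<Rightarrow> real \<Rightarrow> (real ^ 'n \<Rightarrow> real) \<Rightarrow> (real ^ 'n \<Rightarrow> complex) \<Rightarrow> ennreal" where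
  "Morrey_norm p r w f = (SUP Q \<in> Collect is_cube.
     ennreal (wmeasure w Q powr - (1 / p + r / real CARD('n))) * Lp_norm p (\<lambda>x. ennreal (w x)) Q f)"

definition Morrey_lambda_norm ::
  "real \<Rightarrow> real \<Rightarrow> (real ^ 'n \<Rightarrow> real) \<Rightarrow> (real ^ 'n \<Rightarrow> complex) \<Rightarrow> ennreal" where
  "Morrey_lambda_norm p r w f = (SUP Q \<in> Collect is_cube.
     ennreal (measure lebesgue Q powr - (1 / p + r / real CARD('n))) * Lp_norm p (\<lambda>x. ennreal (w x)) Q f)"

definition fspace :: "((real ^ 'n \<Rightarrow> complex) \<Rightarrow> ennreal) \<Rightarrow> (real ^ 'n \<Rightarrow> complex) set" where
  "fspace N = {f \<in> borel_measurable lebesgue. N f < \<infinity>}"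

definition embeds_with ::
  "real \<Rightarrow> ((real ^ 'n \<Rightarrow> complex) \<Rightarrow> ennreal) \<Rightarrow> ((real ^ 'n \<Rightarrow> complex) \<Rightarrow> ennreal) \<Rightarrow> bool" where
  "embeds_with C N N' \<longleftrightarrow> fspace N \<subseteq> fspace N' \<and> (\<forall>f \<in> fspace N. N' f \<le> ennreal C * N f)"

definition embeds ::
  "((real ^ 'n \<Rightarrow> complex) \<Rightarrow> ennreal) \<Rightarrow> ((real ^ 'n \<Rightarrow> complex) \<Rightarrow> ennreal) \<Rightarrow> bool" where
  "embeds N N' \<longleftrightarrow> (\<exists>C. embeds_with C N N')"

definition maximal_weight ::
  "(real ^ 'n \<Rightarrow> real) \<Rightarrow> real \<Rightarrow> (real ^ 'n) set \<Rightarrow> real ^ 'n \<Rightarrow> ennreal" where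
  "maximal_weight w s Q x = ennreal_powr (maximal_op (\<lambda>y. w y powr s * indicator Q y) x) (1 / s)"

end

theory Submission
  imports Defs
begin

text \<open>Let \<open>Q\<^sub>k\<close> be the dilation of \<open>Q\<close> by \<open>2\<^sup>k\<close> and \<open>a\<^sub>k\<close> the average of \<open>w\<close> over \<open>Q\<^sub>k\<close>. Near \<open>Q\<close> the weight
  \<open>M(w\<^sup>s \<chi>\<^sub>Q)\<^bsup>1/s\<^esup>\<close> is dominated by \<open>w\<close>, because \<open>w\<^sup>s\<close> is an \<open>A\<^sub>1\<close> weight; on \<open>Q\<^sub>k - Q\<^bsub>k-1\<^esub>\<close> it is
  dominated by \<open>2\<^bsup>-kn/s\<^esup> a\<^sub>0\<close>, and there \<open>a\<^sub>k \<le> c w\<close>, so the \<open>k\<close>-th annulus contributes at most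
  \<open>2\<^bsup>-kn/s\<^esup> a\<^sub>0 / a\<^sub>k\<close> times the integral of \<open>|f|\<^sup>p w\<close> over \<open>Q\<^sub>k\<close>. Since \<open>a\<^sub>k\<^sup>\<sigma>\<close> is comparable to the average
  of \<open>w\<^sup>\<sigma>\<close> and \<open>w\<^sup>\<sigma>\<close> satisfies a reverse doubling condition, \<open>a\<^sub>0 / a\<^sub>k\<close> is at most a constant times
  \<open>2\<^bsup>kn(1-\<delta>)/\<sigma>\<^esup>\<close> with \<open>\<delta> > 0\<close>. The contributions then form a convergent geometric series for all \<open>s\<close>
  close to \<open>\<nu>\<close>, including at the endpoint values of \<open>r\<close>. The power weights are compared with
  \<open>M(w\<^sup>s \<chi>\<^sub>Q)\<^bsup>1/s\<^esup>\<close> for a cube \<open>Q\<close> centred at the origin, with \<open>\<alpha> = n/s\<close>.\<close>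

section \<open>Cubes and maximal functions\<close>

text \<open>Cubes are parametrised by centre and half side \<open>h\<close>. Dilation about the
  centre then only rescales \<open>h\<close>, and the volume for positive \<open>h\<close> is
  \<open>(2 * h) ^ CARD('n)\<close>.\<close>

definition cube :: "real ^ 'n \<Rightarrow> real \<Rightarrow> (real ^ 'n) set" where
  "cube z h = cbox (z - vec h) (z + vec h)"

lemma mem_cube: "x \<in> cube z h \<longleftrightarrow> (\<forall>i. \<bar>x $ i - z $ i\<bar> \<le> h)"
  unfolding cube_def mem_box_cart by (auto simp: abs_le_iff algebra_simps)

lemma cube_mono: "h \<le> H \<Longrightarrow> cube z h \<subseteq> cube z H"
  by (auto simp: mem_cube) (meson order_trans)

lemma is_cube_iff: "is_cube Q \<longleftrightarrow> (\<exists>z h. 0 < h \<and> Q = cube z h)"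
proof
  assume "is_cube Q"
  then obtain a b l where *: "0 < l" "\<And>i. b $ i - a $ i = l" "Q = cbox a b"
    by (auto simp: is_cube_def)
  have "Q = cube (a + vec (l / 2)) (l / 2)"
    unfolding cube_def *(3) using *(2)
    by (intro arg_cong2[where f = cbox]) (auto simp: vec_eq_iff algebra_simps)
  with *(1) show "\<exists>z h. 0 < h \<and> Q = cube z h"
    by (intro exI[of _ "a + vec (l / 2)"] exI[of _ "l / 2"]) auto
next
  assume "\<exists>z h. 0 < h \<and> Q = cube z h"
  then obtain z h where "0 < h" "Q = cube z h"
    by auto
  then show "is_cube Q"
    unfolding is_cube_def cube_def
    by (intro exI[of _ "z - vec h"] exI[of _ "z + vec h"] exI[of _ "2 * h"]) auto
qed

lemma is_cube_cube: "0 < h \<Longrightarrow> is_cube (cube z h)"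
  by (auto simp: is_cube_iff)

lemma compact_cube: "compact (cube z h)"
  by (simp add: cube_def compact_cbox)

lemma sets_cube [measurable]: "cube z h \<in> sets lebesgue"
  by (simp add: cube_def)

lemma measure_cube:
  fixes z :: "real ^ 'n"
  assumes "0 < h"
  shows "measure lebesgue (cube z h) = (2 * h) ^ CARD('n)"
proof -
  have "z \<in> cbox (z - vec h) (z + vec h)"
    using assms by (auto simp: mem_box_cart)
  then have "cbox (z - vec h) (z + vec h) \<noteq> {}"
    by blast
  from content_cbox_cart[OF this] show ?thesis
    by (simp add: cube_def)
qed

lemma emeasure_cube:
  fixes z :: "real ^ 'n"
  assumes "0 < h"
  shows "emeasure lebesgue (cube z h) = ennreal ((2 * h) ^ CARD('n))"
  unfolding measure_cube[OF assms, of z, symmetric]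
  using emeasure_lborel_cbox_finite[of "z - vec h" "z + vec h"]
  by (intro emeasure_eq_ennreal_measure) (auto simp: cube_def)

lemma cube_volume_pos: "0 < h \<Longrightarrow> 0 < (2 * h) ^ CARD('n)" for h :: real
  by (rule zero_less_power) simp

text \<open>The dilation factor is written with \<open>powr\<close> so that it merges with the real
  exponents of the decay estimates.\<close>

lemma dilated_volume:
  "(2 * (2 ^ k * h)) ^ N = 2 powr (real k * real N) * (2 * h :: real) ^ N"
proof -
  have "2 powr (real k * real N) = ((2::real) ^ k) ^ N"
    by (simp add: powr_realpow[symmetric] powr_powr)
  then show ?thesis
    by (simp only: power_mult_distrib[symmetric] mult.left_commute)
qed

lemma nn_integral_const_cube:
  fixes z :: "real ^ 'n"
  assumes "0 < h"
  shows "(\<integral>\<^sup>+x\<in>cube z h. ennreal a \<partial>lebesgue) = ennreal (a * (2 * h) ^ CARD('n))"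
proof -
  have "(\<integral>\<^sup>+x\<in>cube z h. ennreal a \<partial>lebesgue) = ennreal a * emeasure lebesgue (cube z h)"
    by (rule nn_integral_cmult_indicator) (rule sets_cube)
  also have "\<dots> = ennreal (a * (2 * h) ^ CARD('n))"
    unfolding emeasure_cube[OF assms]
    by (rule ennreal_mult''[symmetric]) (use cube_volume_pos[OF assms, where 'n = 'n] in linarith)
  finally show ?thesis .
qed

section \<open>Powers on the extended half-line\<close>

lemma ennreal_powr_ennreal: "0 \<le> x \<Longrightarrow> ennreal_powr (ennreal x) a = ennreal (x powr a)"
  by (simp add: ennreal_powr_def)

lemma ennreal_powr_mono:
  assumes "0 \<le> a" and "X \<le> Y"
  shows "ennreal_powr X a \<le> ennreal_powr Y a"
proof (cases Y)
  case (real y)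
  then obtain x where "X = ennreal x" "0 \<le> x"
    using assms(2) by (cases X) (auto simp: top_unique)
  then show ?thesis
    using real assms by (auto simp: ennreal_powr_ennreal intro!: ennreal_leI powr_mono2)
qed (simp add: ennreal_powr_def)

text \<open>As \<open>y\<close> is finite, both sides fail for infinite \<open>X\<close>; for finite
  \<open>X\<close> the powers \<open>a\<close> and \<open>1 / a\<close> are monotone and inverse to
  each other. This moves the root in a quasinorm to the finite side of an estimate.\<close>

lemma ennreal_powr_le_iff:
  assumes "0 < a" and "0 \<le> y"
  shows "ennreal_powr X a \<le> ennreal y \<longleftrightarrow> X \<le> ennreal (y powr (1 / a))"
proof (cases X)
  case (real x)
  have "x powr a \<le> y \<longleftrightarrow> x \<le> y powr (1 / a)"
  proof
    assume "x powr a \<le> y"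
    then have "(x powr a) powr (1 / a) \<le> y powr (1 / a)"
      using assms by (intro powr_mono2) auto
    then show "x \<le> y powr (1 / a)"
      using real assms by (simp add: powr_powr)
  next
    assume "x \<le> y powr (1 / a)"
    then have "x powr a \<le> (y powr (1 / a)) powr a"
      using assms real by (intro powr_mono2) auto
    then show "x powr a \<le> y"
      using assms by (simp add: powr_powr)
  qed
  then show ?thesis
    using real assms by (simp add: ennreal_powr_ennreal)
next
  case top
  then show ?thesis
    using assms by (simp add: ennreal_powr_def top_unique)
qed

section \<open>Pointwise bounds for the maximal operator\<close>

lemma maximal_op_leI:
  fixes x :: "real ^ 'n"
  assumes "\<And>y l. 0 < l \<Longrightarrow> x \<in> cube y l \<Longrightarrow>
    (\<integral>\<^sup>+t\<in>cube y l. ennreal \<bar>f t\<bar> \<partial>lebesgue) \<le> ennreal (B * (2 * l) ^ CARD('n))"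
  shows "maximal_op f x \<le> ennreal B"
  unfolding maximal_op_def
proof (intro SUP_least, clarify)
  fix Q :: "(real ^ 'n) set" assume "is_cube Q" "x \<in> Q"
  then obtain y l where Q: "0 < l" "Q = cube y l" "x \<in> cube y l"
    by (auto simp: is_cube_iff)
  have "(\<integral>\<^sup>+t\<in>Q. ennreal \<bar>f t\<bar> \<partial>lebesgue) \<le> ennreal ((2 * l) ^ CARD('n)) * ennreal B"
    using assms[OF Q(1,3)] Q(1,2) by (simp add: ennreal_mult'' mult.commute)
  then show "(\<integral>\<^sup>+t\<in>Q. ennreal \<bar>f t\<bar> \<partial>lebesgue) / emeasure lebesgue Q \<le> ennreal B"
    unfolding Q(2) emeasure_cube[OF Q(1)] using Q(1) by (intro divide_le_posI_ennreal) auto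
qed

text \<open>A cube through \<open>x\<close> that meets \<open>cube z h\<close> has side
  \<open>2 * l \<ge> H - h \<ge> H / 2\<close>, hence volume at least
  \<open>(H / 2) ^ CARD('n)\<close>, while it captures at most the mass \<open>I\<close>. A cube
  that misses \<open>cube z h\<close> contributes nothing.\<close>

lemma maximal_op_far:
  fixes x z :: "real ^ 'n"
  assumes "0 < h" and H: "2 * h \<le> H" and x: "x \<notin> cube z H"
    and I: "(\<integral>\<^sup>+t\<in>cube z h. ennreal \<bar>u t\<bar> \<partial>lebesgue) \<le> ennreal I" and "0 \<le> I"
  shows "maximal_op (\<lambda>t. u t * indicator (cube z h) t) x \<le> ennreal (I / (H / 2) ^ CARD('n))"
proof (rule maximal_op_leI)
  fix y and l :: real assume "0 < l" and xy: "x \<in> cube y l"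
  let ?J = "\<integral>\<^sup>+t\<in>cube y l. ennreal \<bar>u t * indicator (cube z h) t\<bar> \<partial>lebesgue"
  show "?J \<le> ennreal (I / (H / 2) ^ CARD('n) * (2 * l) ^ CARD('n))"
  proof (cases "cube y l \<inter> cube z h = {}")
    case True
    then have "(\<lambda>t. ennreal \<bar>u t * indicator (cube z h) t\<bar> * indicator (cube y l) t) = (\<lambda>_. 0)"
      by (auto simp: indicator_def fun_eq_iff)
    then have "?J = 0"
      by simp
    then show ?thesis
      by simp
  next
    case False
    then obtain q where q: "q \<in> cube y l" "q \<in> cube z h"
      by auto
    obtain i where i: "\<bar>x $ i - z $ i\<bar> > H"
      using x by (auto simp: mem_cube not_le)
    have "\<bar>x $ i - y $ i\<bar> \<le> l" "\<bar>q $ i - y $ i\<bar> \<le> l" "\<bar>q $ i - z $ i\<bar> \<le> h"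
      using xy q by (auto simp: mem_cube)
    with i H have "H / 2 \<le> 2 * l"
      by linarith
    moreover have "0 < H"
      using assms by linarith
    ultimately have "0 < (H / 2) ^ CARD('n)" "(H / 2) ^ CARD('n) \<le> (2 * l) ^ CARD('n)"
      by (intro power_mono zero_less_power; simp)+
    then have "1 \<le> (2 * l) ^ CARD('n) / (H / 2) ^ CARD('n)"
      by (simp only: le_divide_eq_1_pos)
    then have "I * 1 \<le> I * ((2 * l) ^ CARD('n) / (H / 2) ^ CARD('n))"
      using \<open>0 \<le> I\<close> by (intro mult_left_mono)
    then have le: "I \<le> I / (H / 2) ^ CARD('n) * (2 * l) ^ CARD('n)"
      by simp
    have "?J \<le> (\<integral>\<^sup>+t\<in>cube z h. ennreal \<bar>u t\<bar> \<partial>lebesgue)"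
      by (intro nn_integral_mono) (auto simp: indicator_def)
    also note I
    also have "ennreal I \<le> ennreal (I / (H / 2) ^ CARD('n) * (2 * l) ^ CARD('n))"
      using le by (rule ennreal_leI)
    finally show ?thesis .
  qed
qed

text \<open>Centres are taken from a countable dense set and half sides from the positive rationals.
  The centre moves by less than \<open>h / 4\<close>, so every half side above
  \<open>3 / 2 * h\<close> still covers the given cube.\<close>

lemma countable_cube_cover:
  obtains D :: "(real ^ 'n) set" where "countable D"
    and "\<And>z h. 0 < h \<Longrightarrow> \<exists>d\<in>D. \<exists>q\<in>\<rat>. 0 < q \<and> q \<le> 2 * h \<and> cube z h \<subseteq> cube d q"
proof -
  obtain D :: "(real ^ 'n) set" where D: "countable D"
    "\<And>X. open X \<Longrightarrow> X \<noteq> {} \<Longrightarrow> \<exists>d\<in>D. d \<in> X"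
    by (rule countable_dense_setE) blast
  show ?thesis
  proof (rule that[OF D(1)])
    fix z :: "real ^ 'n" and h :: real assume "0 < h"
    then have "ball z (h / 4) \<noteq> {}"
      by simp
    then obtain d where d: "d \<in> D" "dist z d < h / 4"
      using D(2)[of "ball z (h / 4)"] by auto
    obtain q where q: "q \<in> \<rat>" "3 / 2 * h < q" "q < 2 * h"
      using Rats_dense_in_real[of "3 / 2 * h" "2 * h"] \<open>0 < h\<close> by auto
    have zd: "\<bar>z $ i - d $ i\<bar> \<le> h / 4" for i
      using component_le_norm_cart[of "z - d" i] d(2) by (simp add: dist_norm)
    have "\<bar>t $ i - d $ i\<bar> \<le> q" if "\<bar>t $ i - z $ i\<bar> \<le> h" for t i
      using q(2) \<open>0 < h\<close> that zd[of i] by linarith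
    then have "cube z h \<subseteq> cube d q"
      by (auto simp: mem_cube)
    then show "\<exists>d\<in>D. \<exists>q\<in>\<rat>. 0 < q \<and> q \<le> 2 * h \<and> cube z h \<subseteq> cube d q"
      using d q \<open>0 < h\<close> by (intro bexI[of _ d] bexI[of _ q]) auto
  qed
qed

text \<open>The exceptional null set of the hypothesis depends on the cube, so the supremum is first
  reduced to a countable family of cubes; enlarging a cube to a member of that family costs
  the factor \<open>2\<^sup>n\<close>.\<close>

lemma AE_maximal_op_le:
  fixes u v :: "real ^ 'n \<Rightarrow> real"
  assumes A1: "\<And>z h. 0 < h \<Longrightarrow> AE x in lebesgue. x \<in> cube z h \<longrightarrow>
    (\<integral>\<^sup>+t\<in>cube z h. ennreal \<bar>u t\<bar> \<partial>lebesgue) \<le> ennreal (v x * (2 * h) ^ CARD('n))"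
    and v: "\<And>x. 0 \<le> v x"
  shows "AE x in lebesgue. \<forall>E. maximal_op (\<lambda>t. u t * indicator E t) x \<le> ennreal (2 ^ CARD('n) * v x)"
proof -
  let ?I = "\<lambda>z h. \<integral>\<^sup>+t\<in>cube z h. ennreal \<bar>u t\<bar> \<partial>lebesgue"
  obtain D :: "(real ^ 'n) set" where D: "countable D"
    "\<And>z h. 0 < h \<Longrightarrow> \<exists>d\<in>D. \<exists>q\<in>\<rat>. 0 < q \<and> q \<le> 2 * h \<and> cube z h \<subseteq> cube d q"
    by (rule countable_cube_cover) blast
  have "countable (D \<times> (\<rat> \<inter> {0<..}))"
    by (intro countable_SIGMA D countable_Int1 countable_rat)
  moreover have "AE x in lebesgue. x \<in> cube (fst k) (snd k) \<longrightarrow>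
      ?I (fst k) (snd k) \<le> ennreal (v x * (2 * snd k) ^ CARD('n))" if "k \<in> D \<times> (\<rat> \<inter> {0<..})" for k
    using that by (intro A1) auto
  ultimately have "AE x in lebesgue. \<forall>k\<in>D \<times> (\<rat> \<inter> {0<..}). x \<in> cube (fst k) (snd k) \<longrightarrow>
      ?I (fst k) (snd k) \<le> ennreal (v x * (2 * snd k) ^ CARD('n))"
    by (subst AE_ball_countable) auto
  then show ?thesis
  proof (eventually_elim, intro allI)
    \<comment> \<open>The indicator of \<open>E\<close> is simply dropped below, so one null set
      serves for all \<open>E\<close> at once.\<close>
    fix x E assume *: "\<forall>k\<in>D \<times> (\<rat> \<inter> {0<..}). x \<in> cube (fst k) (snd k) \<longrightarrow>
      ?I (fst k) (snd k) \<le> ennreal (v x * (2 * snd k) ^ CARD('n))"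
    show "maximal_op (\<lambda>t. u t * indicator E t) x \<le> ennreal (2 ^ CARD('n) * v x)"
    proof (rule maximal_op_leI)
      fix y and l :: real assume "0 < l" and x: "x \<in> cube y l"
      obtain d q where dq: "d \<in> D" "q \<in> \<rat>" "0 < q" "q \<le> 2 * l" "cube y l \<subseteq> cube d q"
        using D(2)[OF \<open>0 < l\<close>, of y] by auto
      have "(\<integral>\<^sup>+t\<in>cube y l. ennreal \<bar>u t * indicator E t\<bar> \<partial>lebesgue) \<le> ?I d q"
        using dq(5) by (intro nn_integral_mono) (auto simp: indicator_def)
      also have "\<dots> \<le> ennreal (v x * (2 * q) ^ CARD('n))"
        using *[rule_format, of "(d, q)"] dq x by auto
      also have "\<dots> \<le> ennreal (v x * (2 * (2 * l)) ^ CARD('n))"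
        using dq v by (intro ennreal_leI mult_left_mono power_mono) auto
      also have "v x * (2 * (2 * l)) ^ CARD('n) = 2 ^ CARD('n) * v x * (2 * l) ^ CARD('n)"
        by (subst power_mult_distrib) simp
      finally show "(\<integral>\<^sup>+t\<in>cube y l. ennreal \<bar>u t * indicator E t\<bar> \<partial>lebesgue)
          \<le> ennreal (2 ^ CARD('n) * v x * (2 * l) ^ CARD('n))" .
    qed
  qed
qed

section \<open>Averages of a weight over cubes\<close>

definition cube_avg :: "(real ^ 'n \<Rightarrow> real) \<Rightarrow> real ^ 'n \<Rightarrow> real \<Rightarrow> real" where
  "cube_avg w z h = wmeasure w (cube z h) / (2 * h) ^ CARD('n)"

text \<open>The truncations to balls of integer radius are integrable, hence measurable, and at
  every point they are eventually equal to \<open>w\<close>.\<close>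

lemma weight_measurable:
  assumes "weight w"
  shows "w \<in> borel_measurable lebesgue"
proof (rule borel_measurable_LIMSEQ_real)
  show "(\<lambda>x. indicator (cball 0 (real k)) x *\<^sub>R w x) \<in> borel_measurable lebesgue" for k
    using assms by (auto simp: weight_def set_integrable_def intro!: borel_measurable_integrable)
  fix x :: "real ^ 'a"
  obtain N where "norm x < real N"
    using reals_Archimedean2 by blast
  then have "eventually (\<lambda>k. indicator (cball 0 (real k)) x *\<^sub>R w x = w x) sequentially"
    by (auto simp: indicator_def intro!: eventually_sequentiallyI[of N])
  then show "(\<lambda>k. indicator (cball 0 (real k)) x *\<^sub>R w x) \<longlonglongrightarrow> w x"
    by (rule tendsto_eventually)
qed

lemma nn_integral_cube_weight:
  fixes w :: "real ^ 'n \<Rightarrow> real"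
  assumes "weight w" and "0 < h"
  shows "(\<integral>\<^sup>+x\<in>cube z h. ennreal (w x) \<partial>lebesgue) = ennreal (cube_avg w z h * (2 * h) ^ CARD('n))"
proof -
  have "integrable lebesgue (\<lambda>x. indicator (cube z h) x *\<^sub>R w x)"
    using assms(1) compact_cube by (auto simp: weight_def set_integrable_def)
  then have "(\<integral>\<^sup>+x. ennreal (indicator (cube z h) x *\<^sub>R w x) \<partial>lebesgue) = ennreal (wmeasure w (cube z h))"
    unfolding wmeasure_def set_lebesgue_integral_def
    using assms(1) by (intro nn_integral_eq_integral) (auto simp: weight_def)
  moreover have "ennreal (indicator (cube z h) x *\<^sub>R w x) = ennreal (w x) * indicator (cube z h) x" for x
    by (auto simp: indicator_def)
  ultimately show ?thesis
    using assms(2) by (simp add: cube_avg_def)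
qed

section \<open>Morrey norms\<close>

text \<open>Common form of both Morrey quasinorms: \<open>m\<close> is \<open>wmeasure w\<close> or
  Lebesgue measure, and \<open>e\<close> stands for \<open>1 / p + r / n\<close>. The embedding is
  proved once for a general set function \<open>m\<close>.\<close>

definition gen_Morrey_norm ::
  "((real ^ 'n) set \<Rightarrow> real) \<Rightarrow> real \<Rightarrow> real \<Rightarrow> (real ^ 'n \<Rightarrow> real) \<Rightarrow> (real ^ 'n \<Rightarrow> complex) \<Rightarrow> ennreal" where
  "gen_Morrey_norm m e p w f =
     (SUP Q \<in> Collect is_cube. ennreal (m Q powr - e) * Lp_norm p (\<lambda>x. ennreal (w x)) Q f)"

text \<open>Multiplication by \<open>m Q powr e\<close> cancels the normalising factor in the
  supremum. Taking the power \<open>p\<close> then gives a growth bound on the integrals over cubes,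
  the form in which the Morrey condition enters.\<close>

lemma gen_Morrey_norm_integral_le:
  fixes f :: "real ^ 'n \<Rightarrow> complex"
  assumes "gen_Morrey_norm m e p w f = ennreal g" "0 \<le> g" "0 < p" "is_cube Q" "0 < m Q"
  shows "(\<integral>\<^sup>+x\<in>Q. (ennreal (cmod (f x) powr p) * ennreal (w x)) \<partial>lebesgue)
    \<le> ennreal (g powr p * m Q powr (p * e))"
proof -
  have "ennreal (m Q powr - e) * Lp_norm p (\<lambda>x. ennreal (w x)) Q f \<le> ennreal g"
    unfolding assms(1)[symmetric] gen_Morrey_norm_def using assms(4) by (intro SUP_upper) auto
  then have "ennreal (m Q powr e) * (ennreal (m Q powr - e) * Lp_norm p (\<lambda>x. ennreal (w x)) Q f)
      \<le> ennreal (m Q powr e) * ennreal g"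
    by (intro mult_left_mono) auto
  moreover have "ennreal (m Q powr e) * ennreal (m Q powr - e) = 1"
    using assms(5) by (simp add: ennreal_mult[symmetric] powr_add[symmetric])
  ultimately have "Lp_norm p (\<lambda>x. ennreal (w x)) Q f \<le> ennreal (m Q powr e * g)"
    using assms by (simp add: mult.assoc[symmetric] ennreal_mult)
  then show ?thesis
    using assms unfolding Lp_norm_def
    by (subst (asm) ennreal_powr_le_iff) (auto simp: powr_mult powr_powr mult.commute)
qed

lemma term_le_suminf_ennreal: "f k \<le> (\<Sum>k. f k)" for f :: "nat \<Rightarrow> ennreal"
  using sum_le_suminf[of f "{k}"] by simp

lemma Morrey_norm_eq_gen:
  fixes w :: "real ^ 'n \<Rightarrow> real"
  shows "Morrey_norm p r w = gen_Morrey_norm (wmeasure w) (1 / p + r / real CARD('n)) p w"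
  by (simp add: fun_eq_iff Morrey_norm_def gen_Morrey_norm_def)

lemma Morrey_lambda_norm_eq_gen:
  fixes w :: "real ^ 'n \<Rightarrow> real"
  shows "Morrey_lambda_norm p r w = gen_Morrey_norm (measure lebesgue) (1 / p + r / real CARD('n)) p w"
  by (simp add: fun_eq_iff Morrey_lambda_norm_def gen_Morrey_norm_def)

text \<open>Since \<open>\<nu> * s \<ge> 1\<close>, the difference
  \<open>1 / \<nu> - 1 / s = (s - \<nu>) / (\<nu> * s)\<close> is at most
  \<open>s - \<nu>\<close>.\<close>

lemma ex_exponent_near:
  fixes \<nu> \<sigma> \<epsilon> :: real
  assumes "1 \<le> \<nu>" "\<nu> < \<sigma>" "0 < \<epsilon>"
  obtains s\<^sub>0 where "\<nu> < s\<^sub>0" "s\<^sub>0 \<le> \<sigma>" "\<And>s. \<nu> < s \<Longrightarrow> s \<le> s\<^sub>0 \<Longrightarrow> 1 / \<nu> - 1 / s < \<epsilon>"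
proof (rule that[of "min \<sigma> (\<nu> + \<epsilon> / 2)"])
  fix s assume s: "\<nu> < s" "s \<le> min \<sigma> (\<nu> + \<epsilon> / 2)"
  have "1 \<le> \<nu> * s"
    using mult_mono[of 1 \<nu> 1 s] assms s by simp
  then have "(s - \<nu>) / (\<nu> * s) \<le> (s - \<nu>) / 1"
    using s by (intro divide_left_mono) auto
  moreover have "1 / \<nu> - 1 / s = (s - \<nu>) / (\<nu> * s)"
    using assms s by (simp add: field_simps)
  ultimately show "1 / \<nu> - 1 / s < \<epsilon>"
    using s assms by simp
qed (use assms in auto)

section \<open>Weights in \<open>A\<^sub>1\<close> satisfying a reverse Hoelder inequality\<close>

text \<open>Both conditions are normalised to one constant \<open>c \<ge> 1\<close>. The reverse
  Hoelder inequality is raised to the power \<open>\<sigma>\<close> and multiplied by the volume, so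
  that it bounds an integral in [0, infinity].\<close>

locale A1_reverse_Holder =
  fixes w :: "real ^ 'n \<Rightarrow> real" and \<sigma> c :: real
  assumes weight: "weight w"
    and pos: "AE x in lebesgue. 0 < w x"
    and \<sigma>: "1 < \<sigma>"
    and c: "1 \<le> c"
    and A1: "\<And>z h. 0 < h \<Longrightarrow> AE x in lebesgue. x \<in> cube z h \<longrightarrow> cube_avg w z h \<le> c * w x"
    and RH: "\<And>z h. 0 < h \<Longrightarrow> (\<integral>\<^sup>+x\<in>cube z h. ennreal (w x powr \<sigma>) \<partial>lebesgue)
      \<le> ennreal (c * cube_avg w z h powr \<sigma> * (2 * h) ^ CARD('n))"
begin

section \<open>Powers of the weight and their maximal functions\<close>

lemma w_nonneg: "0 \<le> w x"
  using weight by (simp add: weight_def)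

lemma w_measurable [measurable]: "w \<in> borel_measurable lebesgue"
  using weight by (rule weight_measurable)

text \<open>Otherwise the weight would vanish almost everywhere on a cube of positive volume,
  against its positivity almost everywhere.\<close>

lemma avg_pos:
  assumes "0 < h"
  shows "0 < cube_avg w z h"
proof (rule ccontr)
  assume "\<not> 0 < cube_avg w z h"
  then have "cube_avg w z h * (2 * h) ^ CARD('n) \<le> 0"
    using assms by (simp add: mult_nonpos_nonneg)
  then have "(\<integral>\<^sup>+x\<in>cube z h. ennreal (w x) \<partial>lebesgue) = 0"
    using nn_integral_cube_weight[OF weight assms, of z] by (simp add: ennreal_neg)
  then have "AE x in lebesgue. ennreal (w x) * indicator (cube z h) x = 0"
    by (subst (asm) nn_integral_0_iff_AE) auto
  with pos have "AE x in lebesgue. x \<notin> cube z h"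
    by eventually_elim (auto simp: indicator_def split: if_splits)
  then have "emeasure lebesgue (cube z h) = 0"
    by (subst (asm) AE_iff_measurable[of "cube z h"]) auto
  then show False
    using cube_volume_pos[OF assms, where 'n = 'n] unfolding emeasure_cube[OF assms]
    by (metis ennreal_eq_0_iff not_le)
qed

text \<open>Split at the average \<open>a\<close>: where \<open>w \<le> a\<close>, the integrand is
  at most \<open>a powr s\<close>; elsewhere it is at most \<open>a powr (s - \<sigma>)\<close>
  times \<open>w powr \<sigma>\<close>, whose integral the reverse Hoelder inequality controls. The
  constant is \<open>1 + c \<le> 2 * c\<close>.\<close>

lemma powr_integral_le:
  assumes "0 < s" "s \<le> \<sigma>" "0 < h"
  shows "(\<integral>\<^sup>+x\<in>cube z h. ennreal (w x powr s) \<partial>lebesgue)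
    \<le> ennreal (2 * c * cube_avg w z h powr s * (2 * h) ^ CARD('n))"
proof -
  let ?a = "cube_avg w z h" and ?Q = "cube z h"
  have a: "0 < ?a"
    using assms by (intro avg_pos)
  have "w x powr s \<le> ?a powr s + ?a powr (s - \<sigma>) * w x powr \<sigma>" for x
  proof (cases "w x \<le> ?a")
    case True
    then have "w x powr s \<le> ?a powr s"
      using assms w_nonneg by (intro powr_mono2) auto
    then show ?thesis
      by (simp add: add_increasing2)
  next
    case False
    then have "w x powr (s - \<sigma>) * w x powr \<sigma> \<le> ?a powr (s - \<sigma>) * w x powr \<sigma>"
      using assms a by (intro mult_right_mono powr_mono2') auto
    then show ?thesis
      by (simp add: powr_add[symmetric] add_increasing)
  qed
  then have "(\<integral>\<^sup>+x\<in>?Q. ennreal (w x powr s) \<partial>lebesgue)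
      \<le> (\<integral>\<^sup>+x. ennreal (?a powr s) * indicator ?Q x
          + ennreal (?a powr (s - \<sigma>)) * (ennreal (w x powr \<sigma>) * indicator ?Q x) \<partial>lebesgue)"
    by (intro nn_integral_mono)
      (auto simp: indicator_def ennreal_mult[symmetric] ennreal_plus[symmetric] simp del: ennreal_plus intro!: ennreal_leI)
  also have "\<dots> = (\<integral>\<^sup>+x\<in>?Q. ennreal (?a powr s) \<partial>lebesgue)
      + ennreal (?a powr (s - \<sigma>)) * (\<integral>\<^sup>+x\<in>?Q. ennreal (w x powr \<sigma>) \<partial>lebesgue)"
    by (subst nn_integral_add, simp, simp, subst nn_integral_cmult, simp) (rule refl)
  also have "\<dots> \<le> ennreal (?a powr s * (2 * h) ^ CARD('n))
      + ennreal (?a powr (s - \<sigma>)) * ennreal (c * ?a powr \<sigma> * (2 * h) ^ CARD('n))"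
    unfolding nn_integral_const_cube[OF assms(3)] using RH[OF assms(3)]
    by (intro add_mono mult_left_mono order_refl) auto
  also have "\<dots> = ennreal (?a powr s * (2 * h) ^ CARD('n)
      + ?a powr (s - \<sigma>) * (c * ?a powr \<sigma> * (2 * h) ^ CARD('n)))"
    using assms c a by (subst ennreal_mult[symmetric]) (auto intro!: ennreal_plus[symmetric])
  also have "?a powr s * (2 * h) ^ CARD('n) + ?a powr (s - \<sigma>) * (c * ?a powr \<sigma> * (2 * h) ^ CARD('n))
      = (1 + c) * (?a powr s * (2 * h) ^ CARD('n))"
    using a by (simp add: powr_diff field_simps)
  also have "ennreal \<dots> \<le> ennreal (2 * c * (?a powr s * (2 * h) ^ CARD('n)))"
    using c assms by (intro ennreal_leI mult_right_mono) auto
  finally show ?thesis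
    by (simp add: mult.assoc)
qed

text \<open>The power \<open>w powr s\<close> is again an A1 weight: its average over a cube is at
  most \<open>2 * c\<close> times the power \<open>s\<close> of the average of \<open>w\<close>, and
  that average is at most \<open>c * w x\<close> almost everywhere on the cube.\<close>

lemma AE_maximal_weight_le:
  assumes "0 < s" "s \<le> \<sigma>"
  obtains B where "0 < B"
    and "AE x in lebesgue. \<forall>E. maximal_weight w s E x \<le> ennreal (B * w x)"
proof -
  define K where "K = 2 ^ CARD('n) * (2 * c * c powr s)"
  have K: "0 < K"
    using c by (simp add: K_def)
  have "AE x in lebesgue. \<forall>E. maximal_op (\<lambda>t. w t powr s * indicator E t) x
      \<le> ennreal (2 ^ CARD('n) * (2 * c * (c powr s * w x powr s)))"
  proof (rule AE_maximal_op_le)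
    fix z h assume h: "0 < (h::real)"
    have "AE x in lebesgue. x \<in> cube z h \<longrightarrow> cube_avg w z h \<le> c * w x"
      using h by (rule A1)
    then show "AE x in lebesgue. x \<in> cube z h \<longrightarrow>
      (\<integral>\<^sup>+t\<in>cube z h. ennreal \<bar>w t powr s\<bar> \<partial>lebesgue)
        \<le> ennreal (2 * c * (c powr s * w x powr s) * (2 * h) ^ CARD('n))"
    proof (eventually_elim, intro impI)
      fix x assume "x \<in> cube z h \<longrightarrow> cube_avg w z h \<le> c * w x" "x \<in> cube z h"
      then have "cube_avg w z h powr s \<le> c powr s * w x powr s"
        using assms c w_nonneg avg_pos[OF h, of z]
        by (subst powr_mult[symmetric]) (auto intro!: powr_mono2)
      then have "ennreal (2 * c * cube_avg w z h powr s * (2 * h) ^ CARD('n))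
          \<le> ennreal (2 * c * (c powr s * w x powr s) * (2 * h) ^ CARD('n))"
        using c h by (intro ennreal_leI mult_right_mono mult_left_mono) auto
      with powr_integral_le[OF assms h, of z]
      show "(\<integral>\<^sup>+t\<in>cube z h. ennreal \<bar>w t powr s\<bar> \<partial>lebesgue)
          \<le> ennreal (2 * c * (c powr s * w x powr s) * (2 * h) ^ CARD('n))"
        by simp
    qed
  qed (use c in auto)
  then have "AE x in lebesgue. \<forall>E. maximal_weight w s E x \<le> ennreal (K powr (1 / s) * w x)"
  proof (eventually_elim, intro allI)
    fix x E assume "\<forall>E. maximal_op (\<lambda>t. w t powr s * indicator E t) x
      \<le> ennreal (2 ^ CARD('n) * (2 * c * (c powr s * w x powr s)))"
    then have "maximal_op (\<lambda>t. w t powr s * indicator E t) x \<le> ennreal (K * w x powr s)"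
      by (simp add: K_def mult.assoc)
    also have "K * w x powr s = (K powr (1 / s) * w x) powr (1 / (1 / s))"
      using K w_nonneg assms by (simp add: powr_mult powr_powr)
    finally show "maximal_weight w s E x \<le> ennreal (K powr (1 / s) * w x)"
      using assms w_nonneg unfolding maximal_weight_def by (subst ennreal_powr_le_iff) auto
  qed
  with that[of "K powr (1 / s)"] K show ?thesis
    by simp
qed

text \<open>The mass of \<open>w powr s\<close> on the small cube is divided by the volume
  \<open>(H / 2) ^ CARD('n)\<close>. The volume ratio \<open>(4 * h / H) ^ CARD('n)\<close> becomes
  a decay of order \<open>CARD('n) / s\<close> after the root.\<close>

lemma maximal_weight_far:
  assumes "0 < s" "s \<le> \<sigma>" "0 < h" "2 * h \<le> H" "x \<notin> cube z H"
  shows "maximal_weight w s (cube z h) x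
    \<le> ennreal ((2 * c) powr (1 / s) * (4 * h / H) powr (CARD('n) / s) * cube_avg w z h)"
proof -
  let ?a = "cube_avg w z h"
  have a: "0 < ?a"
    using assms by (intro avg_pos)
  have H: "0 < H"
    using assms by linarith
  have 4: "4 * h / H = (2 * h) / (H / 2)"
    by simp
  have "maximal_op (\<lambda>t. w t powr s * indicator (cube z h) t) x
      \<le> ennreal ((2 * c * ?a powr s * (2 * h) ^ CARD('n)) / (H / 2) ^ CARD('n))"
    using powr_integral_le[OF assms(1-3), of z] c assms by (intro maximal_op_far) auto
  also have "(2 * c * ?a powr s * (2 * h) ^ CARD('n)) / (H / 2) ^ CARD('n)
      = 2 * c * ?a powr s * (4 * h / H) ^ CARD('n)"
    unfolding 4 by (simp only: power_divide times_divide_eq_right)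
  also have "\<dots> = ((2 * c) powr (1 / s) * (4 * h / H) powr (CARD('n) / s) * ?a) powr (1 / (1 / s))"
    using assms c a H by (simp add: powr_mult powr_powr powr_realpow[symmetric])
  finally show ?thesis
    using assms a unfolding maximal_weight_def by (subst ennreal_powr_le_iff) auto
qed

section \<open>Behaviour of averages under dilation\<close>

text \<open>Lower counterpart of \<open>powr_integral_le\<close>: by the A1 condition
  \<open>w\<close> is at least its average divided by \<open>c\<close> almost everywhere on the
  cube.\<close>

lemma avg_powr_le:
  assumes "0 < s" "0 < h"
  shows "ennreal ((cube_avg w z h / c) powr s * (2 * h) ^ CARD('n))
    \<le> (\<integral>\<^sup>+x\<in>cube z h. ennreal (w x powr s) \<partial>lebesgue)"
proof -
  let ?a = "cube_avg w z h" and ?Q = "cube z h"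
  have a: "0 < ?a"
    using assms by (intro avg_pos)
  have "ennreal ((?a / c) powr s * (2 * h) ^ CARD('n)) = (\<integral>\<^sup>+x\<in>?Q. ennreal ((?a / c) powr s) \<partial>lebesgue)"
    using assms(2) by (rule nn_integral_const_cube[symmetric])
  also have "\<dots> \<le> (\<integral>\<^sup>+x\<in>?Q. ennreal (w x powr s) \<partial>lebesgue)"
  proof (rule nn_integral_mono_AE)
    show "AE x in lebesgue. ennreal ((?a / c) powr s) * indicator ?Q x \<le> ennreal (w x powr s) * indicator ?Q x"
      using A1[OF assms(2), of z]
    proof eventually_elim
      fix x assume *: "x \<in> ?Q \<longrightarrow> ?a \<le> c * w x"
      show "ennreal ((?a / c) powr s) * indicator ?Q x \<le> ennreal (w x powr s) * indicator ?Q x"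
      proof (cases "x \<in> ?Q")
        case True
        then have "?a / c \<le> w x"
          using * c by (simp add: field_simps)
        then show ?thesis
          using True a c assms by (auto intro!: ennreal_leI powr_mono2)
      qed simp
    qed
  qed
  finally show ?thesis .
qed

text \<open>On the larger cube \<open>w\<close> is almost everywhere at least its average there
  divided by \<open>c\<close>; integrating this over the smaller cube gives the claim.\<close>

lemma avg_mono:
  assumes "0 < h" "h \<le> H"
  shows "cube_avg w z H \<le> c * cube_avg w z h"
proof -
  have H: "0 < H"
    using assms by linarith
  have "ennreal (cube_avg w z H / c * (2 * h) ^ CARD('n)) = (\<integral>\<^sup>+x\<in>cube z h. ennreal (cube_avg w z H / c) \<partial>lebesgue)"
    using assms(1) by (rule nn_integral_const_cube[symmetric])
  also have "\<dots> \<le> (\<integral>\<^sup>+x\<in>cube z h. ennreal (w x) \<partial>lebesgue)"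
  proof (rule nn_integral_mono_AE)
    show "AE x in lebesgue. ennreal (cube_avg w z H / c) * indicator (cube z h) x \<le> ennreal (w x) * indicator (cube z h) x"
      using A1[OF H, of z]
    proof eventually_elim
      case (elim x)
      then show ?case
        using c cube_mono[OF assms(2), of z]
        by (auto simp: indicator_def field_simps intro!: ennreal_leI)
    qed
  qed
  also have "\<dots> = ennreal (cube_avg w z h * (2 * h) ^ CARD('n))"
    using nn_integral_cube_weight[OF weight assms(1)] .
  finally have "cube_avg w z H / c * (2 * h) ^ CARD('n) \<le> cube_avg w z h * (2 * h) ^ CARD('n)"
    using avg_pos[OF assms(1), of z] assms by (subst (asm) ennreal_le_iff) auto
  then show ?thesis
    using c assms by (simp add: field_simps)
qed

text \<open>The weight \<open>w\<^sup>\<sigma>\<close> is at least a fixed multiple of its average on the doubled cube, hence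
  it has a fixed portion of its mass outside the original cube. This strict gain takes the place
  of a self-improvement of the reverse Hoelder exponent at the endpoint values of \<open>r\<close>.\<close>

lemma reverse_doubling:
  obtains \<rho> where "1 < \<rho>"
    and "\<And>z h. 0 < h \<Longrightarrow> ennreal \<rho> * (\<integral>\<^sup>+x\<in>cube z h. ennreal (w x powr \<sigma>) \<partial>lebesgue)
      \<le> (\<integral>\<^sup>+x\<in>cube z (2 * h). ennreal (w x powr \<sigma>) \<partial>lebesgue)"
proof -
  \<comment> \<open>A lower bound for the fraction of the mass of \<open>w powr \<sigma>\<close> on
    the doubled cube that lies outside the original one. With volume \<open>m\<close> and average
    \<open>a\<close> of the doubled cube, the shell carries at least
    \<open>(a / c) powr \<sigma> * (1 - 1 / 2 ^ CARD('n)) * m\<close>, and the total is at most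
    \<open>c * a powr \<sigma> * m\<close>.\<close>
  define \<eta> where "\<eta> = (1 - 1 / 2 ^ CARD('n)) / (c * c powr \<sigma>)"
  have N: "(1::real) < 2 ^ CARD('n)"
    by (rule one_less_power) auto
  have "1 \<le> c powr \<sigma>"
    using c \<sigma> by (intro ge_one_powr_ge_zero) auto
  then have cc: "1 \<le> c * c powr \<sigma>"
    using c mult_mono[of 1 c 1 "c powr \<sigma>"] by simp
  have "0 < 1 - 1 / (2::real) ^ CARD('n)" "1 - 1 / (2::real) ^ CARD('n) < 1"
    using N by auto
  then have "0 < 1 - 1 / (2::real) ^ CARD('n)" "1 - 1 / 2 ^ CARD('n) < c * c powr \<sigma>"
    using cc by linarith+
  then have \<eta>: "0 < \<eta>" "\<eta> < 1"
    using cc unfolding \<eta>_def by (auto simp only: divide_less_eq_1_pos zero_less_divide_iff)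
  let ?V = "\<lambda>E. \<integral>\<^sup>+x\<in>E. ennreal (w x powr \<sigma>) \<partial>lebesgue"
  show ?thesis
  proof (rule that[of "1 / (1 - \<eta>)"])
    show "1 < 1 / (1 - \<eta>)"
      using \<eta> by simp
    fix z h assume h: "0 < (h::real)"
    then have H: "0 < 2 * h"
      by simp
    define a m where "a = cube_avg w z (2 * h)" and "m = (2 * (2 * h)) ^ CARD('n)"
    have a: "0 < a" and m: "0 < m"
      using avg_pos[OF H] cube_volume_pos[OF H] by (auto simp: a_def m_def)
    have mh: "(2 * h) ^ CARD('n) = m / 2 ^ CARD('n)"
      unfolding m_def by (subst (2) power_mult_distrib) simp
    have V1: "?V (cube z (2 * h)) \<le> ennreal (c * a powr \<sigma> * m)"
      using RH[OF H, of z] by (simp only: a_def m_def)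
    define v1 where "v1 = enn2real (?V (cube z (2 * h)))"
    have v1: "?V (cube z (2 * h)) = ennreal v1" "0 \<le> v1"
      using le_less_trans[OF V1] by (simp_all add: v1_def)
    have sub: "cube z h \<subseteq> cube z (2 * h)"
      using h by (intro cube_mono) simp
    have "?V (cube z h) \<le> ?V (cube z (2 * h))"
      using sub by (intro nn_integral_mono) (auto simp: indicator_def)
    define v0 where "v0 = enn2real (?V (cube z h))"
    have v0: "?V (cube z h) = ennreal v0" "0 \<le> v0"
      using le_less_trans[OF \<open>?V (cube z h) \<le> _\<close>] v1 by (simp_all add: v0_def)
    let ?b = "(a / c) powr \<sigma>"
    \<comment> \<open>The mass bound on the shell, arranged without subtraction in [0, infinity]. On
      the small cube both integrands agree; on the shell the inequality reduces to
      \<open>?b \<le> w x powr \<sigma>\<close>.\<close>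
    have "ennreal v0 + ennreal (?b * m) \<le> ennreal v1 + ennreal (?b * (m / 2 ^ CARD('n)))"
    proof -
      have "ennreal v0 + ennreal (?b * m)
          = (\<integral>\<^sup>+x. ennreal (w x powr \<sigma>) * indicator (cube z h) x + ennreal ?b * indicator (cube z (2 * h)) x \<partial>lebesgue)"
        by (subst nn_integral_add, simp, simp) (simp only: v0 nn_integral_const_cube[OF H] m_def)
      also have "\<dots> \<le> (\<integral>\<^sup>+x. ennreal (w x powr \<sigma>) * indicator (cube z (2 * h)) x + ennreal ?b * indicator (cube z h) x \<partial>lebesgue)"
      proof (rule nn_integral_mono_AE)
        show "AE x in lebesgue. ennreal (w x powr \<sigma>) * indicator (cube z h) x + ennreal ?b * indicator (cube z (2 * h)) x
          \<le> ennreal (w x powr \<sigma>) * indicator (cube z (2 * h)) x + ennreal ?b * indicator (cube z h) x"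
          using A1[OF H, of z]
        proof eventually_elim
          fix x assume "x \<in> cube z (2 * h) \<longrightarrow> cube_avg w z (2 * h) \<le> c * w x"
          then have "x \<in> cube z (2 * h) \<Longrightarrow> ?b \<le> w x powr \<sigma>"
            using c a \<sigma> by (auto simp: a_def field_simps intro!: powr_mono2)
          then show "ennreal (w x powr \<sigma>) * indicator (cube z h) x + ennreal ?b * indicator (cube z (2 * h)) x
              \<le> ennreal (w x powr \<sigma>) * indicator (cube z (2 * h)) x + ennreal ?b * indicator (cube z h) x"
            using sub by (auto simp: indicator_def ennreal_leI)
        qed
      qed
      also have "\<dots> = ennreal v1 + ennreal (?b * (m / 2 ^ CARD('n)))"
        by (subst nn_integral_add, simp, simp) (simp only: v1 nn_integral_const_cube[OF h] mh)
      finally show ?thesis .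
    qed
    then have "v0 + ?b * m \<le> v1 + ?b * (m / 2 ^ CARD('n))"
      using v0 v1 m by (simp add: ennreal_plus[symmetric] del: ennreal_plus)
    moreover have "v1 \<le> c * a powr \<sigma> * m"
      using V1 v1 c a m by (simp add: ennreal_le_iff)
    then have "\<eta> * v1 \<le> \<eta> * (c * a powr \<sigma> * m)"
      using \<eta> by (intro mult_left_mono) auto
    moreover have "\<eta> * (c * a powr \<sigma> * m) = ?b * m - ?b * (m / 2 ^ CARD('n))"
      using c a by (simp add: \<eta>_def powr_divide field_simps)
    ultimately have "v0 \<le> (1 - \<eta>) * v1"
      by (simp add: algebra_simps)
    then have "1 / (1 - \<eta>) * v0 \<le> v1"
      using \<eta> by (simp add: field_simps)
    then show "ennreal (1 / (1 - \<eta>)) * ?V (cube z h) \<le> ?V (cube z (2 * h))"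
      unfolding v0 v1 using v0 \<eta> by (subst ennreal_mult[symmetric]) (auto intro!: ennreal_leI)
  qed
qed

text \<open>Iterated reverse doubling, with \<open>avg_powr_le\<close> below and the reverse Hoelder
  inequality above, compares the powers \<open>\<sigma>\<close> of the two averages. The volumes
  contribute a factor \<open>2 powr (k * n)\<close>, the iteration gains \<open>\<rho> ^ k\<close>,
  and the root of order \<open>\<sigma>\<close> is taken last.\<close>

lemma avg_decay:
  obtains \<delta> C :: real where "0 < \<delta>" "0 < C"
    and "\<And>z h k. 0 < h \<Longrightarrow>
      cube_avg w z h \<le> C * 2 powr (real k * (real CARD('n) * (1 - \<delta>) / \<sigma>)) * cube_avg w z (2 ^ k * h)"
proof -
  let ?V = "\<lambda>z h. \<integral>\<^sup>+x\<in>cube z h. ennreal (w x powr \<sigma>) \<partial>lebesgue"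
  obtain \<rho> where \<rho>: "1 < \<rho>" "\<And>z h. 0 < h \<Longrightarrow> ennreal \<rho> * ?V z h \<le> ?V z (2 * h)"
    by (rule reverse_doubling) blast
  have iter: "ennreal (\<rho> ^ k) * ?V z h \<le> ?V z (2 ^ k * h)" if "0 < h" for z h k
  proof (induction k)
    case (Suc k)
    have "ennreal (\<rho> ^ Suc k) * ?V z h = ennreal \<rho> * (ennreal (\<rho> ^ k) * ?V z h)"
      using \<rho>(1) by (simp add: ennreal_mult mult.assoc)
    also have "\<dots> \<le> ennreal \<rho> * ?V z (2 ^ k * h)"
      using Suc by (intro mult_left_mono) auto
    also have "\<dots> \<le> ?V z (2 * (2 ^ k * h))"
      using that by (intro \<rho>(2)) auto
    finally show ?case
      by (simp add: mult.assoc)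
  qed simp
  \<comment> \<open>Chosen so that the doubling gain \<open>\<rho>\<close> equals
    \<open>2 powr (n * \<delta>)\<close>.\<close>
  define \<delta> where "\<delta> = log 2 \<rho> / CARD('n)"
  have "0 < \<delta>"
    using \<rho>(1) by (simp add: \<delta>_def)
  have \<rho>_eq: "\<rho> = 2 powr (real CARD('n) * \<delta>)"
    using \<rho>(1) by (simp add: \<delta>_def)
  show ?thesis
  proof (rule that[of \<delta> "(c * c powr \<sigma>) powr (1 / \<sigma>)"])
    fix z h and k :: nat assume h: "0 < (h::real)"
    then have H: "0 < 2 ^ k * h"
      by simp
    define a b m where "a = cube_avg w z h" and "b = cube_avg w z (2 ^ k * h)"
      and "m = (2 * h) ^ CARD('n)"
    have a: "0 < a" and b: "0 < b" and m: "0 < m"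
      using avg_pos[OF h] avg_pos[OF H] cube_volume_pos[OF h] by (auto simp: a_def b_def m_def)
    have mH: "(2 * (2 ^ k * h)) ^ CARD('n) = 2 powr (real k * real CARD('n)) * m"
      unfolding m_def by (rule dilated_volume)
    have "ennreal (\<rho> ^ k * ((a / c) powr \<sigma> * m)) = ennreal (\<rho> ^ k) * ennreal ((a / c) powr \<sigma> * m)"
      using \<rho>(1) by (simp add: ennreal_mult')
    also have "\<dots> \<le> ennreal (\<rho> ^ k) * ?V z h"
      unfolding a_def m_def using \<sigma> h by (intro mult_left_mono avg_powr_le) auto
    also have "\<dots> \<le> ?V z (2 ^ k * h)"
      using h by (rule iter)
    also have "\<dots> \<le> ennreal (c * b powr \<sigma> * (2 powr (real k * real CARD('n)) * m))"
      using RH[OF H, of z] by (simp only: b_def mH)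
    finally have "\<rho> ^ k * ((a / c) powr \<sigma> * m) \<le> c * b powr \<sigma> * (2 powr (real k * real CARD('n)) * m)"
      using c b m by (subst (asm) ennreal_le_iff) auto
    then have "\<rho> ^ k * (a / c) powr \<sigma> \<le> c * b powr \<sigma> * 2 powr (real k * real CARD('n))"
      using m by (simp add: mult.assoc[symmetric])
    moreover have "\<rho> ^ k = 2 powr (real k * (real CARD('n) * \<delta>))"
      by (simp add: \<rho>_eq powr_power)
    ultimately have "a powr \<sigma> \<le> c * c powr \<sigma> * (2 powr (real k * real CARD('n)) / 2 powr (real k * (real CARD('n) * \<delta>))) * b powr \<sigma>"
      using c a by (simp add: powr_divide field_simps)
    also have "2 powr (real k * real CARD('n)) / 2 powr (real k * (real CARD('n) * \<delta>)) = 2 powr (real k * (real CARD('n) * (1 - \<delta>)))"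
      by (simp add: powr_diff[symmetric] right_diff_distrib)
    finally have "(a powr \<sigma>) powr (1 / \<sigma>) \<le> (c * c powr \<sigma> * 2 powr (real k * (real CARD('n) * (1 - \<delta>))) * b powr \<sigma>) powr (1 / \<sigma>)"
      using \<sigma> by (intro powr_mono2) auto
    then show "a \<le> (c * c powr \<sigma>) powr (1 / \<sigma>) * 2 powr (real k * (real CARD('n) * (1 - \<delta>) / \<sigma>)) * b"
      using \<sigma> a b c by (simp add: powr_mult powr_powr)
  qed (use c \<open>0 < \<delta>\<close> in auto)
qed

section \<open>Summation over dilated cubes\<close>

text \<open>By the A1 condition \<open>1 \<le> c / a * w x\<close> almost everywhere on a cube with
  average \<open>a\<close>, so the weight may be inserted into an unweighted integral at the price
  \<open>c / a\<close>.\<close>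

lemma nn_integral_le_weighted:
  assumes "0 < h" and [measurable]: "F \<in> borel_measurable lebesgue"
    and le: "(\<integral>\<^sup>+x\<in>cube z h. (F x * ennreal (w x)) \<partial>lebesgue) \<le> ennreal y" and "0 \<le> y"
  shows "(\<integral>\<^sup>+x\<in>cube z h. F x \<partial>lebesgue) \<le> ennreal (c / cube_avg w z h * y)"
proof -
  let ?a = "cube_avg w z h"
  have a: "0 < ?a"
    using assms by (intro avg_pos)
  have "(\<integral>\<^sup>+x\<in>cube z h. F x \<partial>lebesgue)
      \<le> (\<integral>\<^sup>+x. ennreal (c / ?a) * (F x * ennreal (w x) * indicator (cube z h) x) \<partial>lebesgue)"
  proof (rule nn_integral_mono_AE)
    show "AE x in lebesgue. F x * indicator (cube z h) x
        \<le> ennreal (c / ?a) * (F x * ennreal (w x) * indicator (cube z h) x)"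
      using A1[OF assms(1), of z]
    proof eventually_elim
      fix x assume *: "x \<in> cube z h \<longrightarrow> ?a \<le> c * w x"
      show "F x * indicator (cube z h) x \<le> ennreal (c / ?a) * (F x * ennreal (w x) * indicator (cube z h) x)"
      proof (cases "x \<in> cube z h")
        case True
        then have "1 \<le> c / ?a * w x"
          using * a by (simp add: field_simps)
        then have "1 \<le> ennreal (c / ?a * w x)"
          by simp
        also have "\<dots> = ennreal (c / ?a) * ennreal (w x)"
          using c a w_nonneg by (intro ennreal_mult) auto
        finally have "F x * 1 \<le> F x * (ennreal (c / ?a) * ennreal (w x))"
          by (intro mult_left_mono) auto
        then show ?thesis
          using True by (simp add: mult_ac)
      qed simp
    qed
  qed
  also have "\<dots> = ennreal (c / ?a) * (\<integral>\<^sup>+x\<in>cube z h. (F x * ennreal (w x)) \<partial>lebesgue)"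
    by (intro nn_integral_cmult) measurable
  also have "\<dots> \<le> ennreal (c / ?a) * ennreal y"
    using le by (intro mult_left_mono) auto
  also have "\<dots> = ennreal (c / ?a * y)"
    using c a assms by (intro ennreal_mult[symmetric]) auto
  finally show ?thesis .
qed

text \<open>The first summand covers the doubled cube. The series runs over full dilated cubes
  instead of annuli: its terms are nonnegative, so the single term of the smallest dilate containing
  \<open>x\<close> already suffices.\<close>

lemma AE_maximal_weight_annuli:
  assumes "0 < s" "s \<le> \<sigma>"
  obtains B D where "0 < B" "0 < D"
    and "\<And>z h. 0 < h \<Longrightarrow> AE x in lebesgue. maximal_weight w s (cube z h) x
      \<le> ennreal (B * w x) * indicator (cube z (2 * h)) x
        + (\<Sum>k. ennreal (D * 2 powr - (real k * (CARD('n) / s)) * cube_avg w z h)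
            * indicator (cube z (2 ^ k * h)) x)"
proof -
  obtain B where B: "0 < B" "AE x in lebesgue. \<forall>E. maximal_weight w s E x \<le> ennreal (B * w x)"
    by (rule AE_maximal_weight_le[OF assms])
  \<comment> \<open>The factor 8 arises from
    \<open>4 * h / (2 ^ (k - 1) * h) = 8 * 2 powr - k\<close>.\<close>
  define D where "D = (2 * c) powr (1 / s) * 8 powr (CARD('n) / s)"
  show ?thesis
  proof (rule that[of B D])
    show "0 < D"
      using c by (simp add: D_def)
    fix z h assume h: "0 < (h::real)"
    let ?t = "\<lambda>x k. ennreal (D * 2 powr - (real k * (CARD('n) / s)) * cube_avg w z h)
      * indicator (cube z (2 ^ k * h)) x"
    show "AE x in lebesgue. maximal_weight w s (cube z h) x
      \<le> ennreal (B * w x) * indicator (cube z (2 * h)) x + (\<Sum>k. ?t x k)"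
      using B(2)
    proof eventually_elim
      fix x assume *: "\<forall>E. maximal_weight w s E x \<le> ennreal (B * w x)"
      show "maximal_weight w s (cube z h) x
        \<le> ennreal (B * w x) * indicator (cube z (2 * h)) x + (\<Sum>k. ?t x k)"
      proof (cases "x \<in> cube z (2 * h)")
        case True
        then show ?thesis
          using * by (simp add: add_increasing2)
      next
        case far: False
        obtain k\<^sub>0 where k0: "norm (x - z) / h < 2 ^ k\<^sub>0"
          using real_arch_pow[of 2 "norm (x - z) / h"] by auto
        have "x \<in> cube z (2 ^ k\<^sub>0 * h)"
          unfolding mem_cube
        proof
          fix i
          have "\<bar>x $ i - z $ i\<bar> \<le> norm (x - z)"
            using component_le_norm_cart[of "x - z" i] by simp
          also have "\<dots> \<le> 2 ^ k\<^sub>0 * h"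
            using k0 h by (simp add: field_simps)
          finally show "\<bar>x $ i - z $ i\<bar> \<le> 2 ^ k\<^sub>0 * h" .
        qed
        \<comment> \<open>As \<open>x\<close> lies outside the doubled cube,
          \<open>k \<ge> 2\<close>. By minimality \<open>x\<close> is outside the dilate of half
          side \<open>2 ^ (k - 1) * h\<close>, which is at least \<open>2 * h\<close> as the far
          estimate demands.\<close>
        define k where "k = (LEAST k. x \<in> cube z (2 ^ k * h))"
        have k: "x \<in> cube z (2 ^ k * h)"
          unfolding k_def by (rule LeastI) fact
        have "k \<noteq> 0" "k \<noteq> 1"
          using far k cube_mono[of h "2 * h" z] h by (intro notI; auto)+
        then obtain j where j: "k = Suc (Suc j)"
          by (metis One_nat_def not0_implies_Suc)
        have "x \<notin> cube z (2 ^ Suc j * h)"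
          using not_less_Least[of "Suc j" "\<lambda>k. x \<in> cube z (2 ^ k * h)"] j by (simp add: k_def)
        then have "maximal_weight w s (cube z h) x
            \<le> ennreal ((2 * c) powr (1 / s) * (4 * h / (2 ^ Suc j * h)) powr (CARD('n) / s) * cube_avg w z h)"
          using assms h by (intro maximal_weight_far) auto
        also have "4 * h / (2 ^ Suc j * h) = 8 * 2 powr - real k"
        proof -
          have "2 powr - real k = 1 / 2 ^ k"
            by (simp add: powr_minus powr_realpow divide_inverse)
          then show ?thesis
            using h by (simp add: j)
        qed
        also have "(8 * 2 powr - real k) powr (CARD('n) / s)
            = 8 powr (CARD('n) / s) * 2 powr - (real k * (CARD('n) / s))"
          by (simp add: powr_mult powr_powr)
        also have "ennreal ((2 * c) powr (1 / s) * (8 powr (CARD('n) / s) * 2 powr - (real k * (CARD('n) / s))) * cube_avg w z h)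
            = ?t x k"
          using k by (simp add: D_def mult.assoc)
        also have "\<dots> \<le> (\<Sum>k. ?t x k)"
          by (rule term_le_suminf_ennreal)
        finally show ?thesis
          by (simp add: add_increasing)
      qed
    qed
  qed (rule B(1))
qed

text \<open>Integrate \<open>|f|^p\<close> against the series bound. The unweighted integral over
  the \<open>k\<close>-th dilate costs \<open>c\<close> over its average, and \<open>decay\<close>
  is exactly the condition that makes the resulting terms geometric; it is the only place where the
  choice of \<open>m\<close> and \<open>e\<close> matters.\<close>

theorem embedding:
  assumes p: "0 < p" and s: "0 < s" "s \<le> \<sigma>"
    and m: "\<And>z h. 0 < h \<Longrightarrow> 0 < m (cube z h)"
    and C: "0 \<le> C" and \<gamma>: "0 < \<gamma>" "\<gamma> < 1"
    and decay: "\<And>z h k. 0 < h \<Longrightarrow>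
      2 powr - (real k * (CARD('n) / s)) * (cube_avg w z h / cube_avg w z (2 ^ k * h))
        * m (cube z (2 ^ k * h)) powr (p * e) \<le> C * \<gamma> ^ k * m (cube z h) powr (p * e)"
  shows "\<exists>C'. \<forall>Q. is_cube Q \<longrightarrow>
    embeds_with (C' * m Q powr e) (gen_Morrey_norm m e p w) (Lp_norm p (maximal_weight w s Q) UNIV)"
proof -
  obtain B D where BD: "0 < B" "0 < D" and W: "\<And>z h. 0 < h \<Longrightarrow>
    AE x in lebesgue. maximal_weight w s (cube z h) x
      \<le> ennreal (B * w x) * indicator (cube z (2 * h)) x
        + (\<Sum>k. ennreal (D * 2 powr - (real k * (CARD('n) / s)) * cube_avg w z h)
            * indicator (cube z (2 ^ k * h)) x)"
    using AE_maximal_weight_annuli[OF s] by blast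
  \<comment> \<open>The first summand stems from the doubled cube, the second from the geometric
    series.\<close>
  define A where "A = B * (2 powr (CARD('n) / s) * c * C) + D * c * C * (1 / (1 - \<gamma>))"
  have A: "0 \<le> A"
    using BD C c \<gamma> by (simp add: A_def)
  have main: "Lp_norm p (maximal_weight w s (cube z h)) UNIV f
      \<le> ennreal (A powr (1 / p) * m (cube z h) powr e * g)"
    if h: "0 < h" and f: "f \<in> borel_measurable lebesgue"
      and g: "gen_Morrey_norm m e p w f = ennreal g" "0 \<le> g" for z h f g
  proof -
    define F where "F x = ennreal (cmod (f x) powr p)" for x
    have F [measurable]: "F \<in> borel_measurable lebesgue"
      unfolding F_def using f by measurable
    define M where "M k = m (cube z (2 ^ k * h)) powr (p * e)" for k :: nat
    define a where "a k = cube_avg w z (2 ^ k * h)" for k :: nat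
    define t where "t k = D * 2 powr - (real k * (CARD('n) / s)) * a 0" for k :: nat
    have a: "0 < a k" for k
      unfolding a_def using h by (intro avg_pos) auto
    have t: "0 \<le> t k" for k
      using BD a[of 0] by (simp add: t_def)
    have hk: "0 < 2 ^ k * h" for k :: nat
      using h by simp
    have J: "(\<integral>\<^sup>+x\<in>cube z (2 ^ k * h). (F x * ennreal (w x)) \<partial>lebesgue) \<le> ennreal (g powr p * M k)" for k :: nat
      unfolding F_def M_def using hk by (intro gen_Morrey_norm_integral_le g p is_cube_cube m)
    have J': "(\<integral>\<^sup>+x\<in>cube z (2 ^ k * h). F x \<partial>lebesgue) \<le> ennreal (c / a k * (g powr p * M k))" for k :: nat
      unfolding a_def using hk J by (intro nn_integral_le_weighted) (auto simp: M_def)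
    have M: "2 powr - (real k * (CARD('n) / s)) * (a 0 / a k) * M k \<le> C * \<gamma> ^ k * M 0" for k
      using decay[OF h, of k z] by (simp add: a_def M_def)
    \<comment> \<open>The case \<open>k = 1\<close> of \<open>decay\<close> bounds
      \<open>(a 0 / a 1) * M 1\<close>; the ratio is removed with
      \<open>a 1 / a 0 \<le> c\<close>.\<close>
    have "M 1 \<le> 2 powr (CARD('n) / s) * c * C * M 0"
    proof -
      have "a 1 / a 0 \<le> c"
        using avg_mono[of h "2 * h" z] h a[of 0] by (simp add: a_def field_simps)
      have "2 powr (CARD('n) / s) * 2 powr - (real 1 * (CARD('n) / s)) = 1"
        by (simp add: powr_add[symmetric])
      then have "M 1 = 2 powr (CARD('n) / s) * (a 1 / a 0) * (2 powr - (real 1 * (CARD('n) / s)) * (a 0 / a 1) * M 1)"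
        using a[of 0] a[of 1] by (simp add: mult_ac)
      also have "\<dots> \<le> 2 powr (CARD('n) / s) * (a 1 / a 0) * (C * \<gamma> ^ 1 * M 0)"
        using a[of 0] a[of 1] by (intro mult_left_mono M) auto
      also have "\<dots> \<le> 2 powr (CARD('n) / s) * c * (C * 1 * M 0)"
        using \<gamma> C c a[of 0] a[of 1] \<open>a 1 / a 0 \<le> c\<close> by (intro mult_mono) (auto simp: M_def intro!: mult_left_le mult_right_mono)
      finally show ?thesis
        by (simp add: mult.assoc)
    qed
    have "(\<integral>\<^sup>+x. F x * maximal_weight w s (cube z h) x \<partial>lebesgue)
      \<le> (\<integral>\<^sup>+x. ennreal B * (F x * ennreal (w x) * indicator (cube z (2 ^ 1 * h)) x)
          + (\<Sum>k. ennreal (t k) * (F x * indicator (cube z (2 ^ k * h)) x)) \<partial>lebesgue)"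
    proof (rule nn_integral_mono_AE)
      show "AE x in lebesgue. F x * maximal_weight w s (cube z h) x
        \<le> ennreal B * (F x * ennreal (w x) * indicator (cube z (2 ^ 1 * h)) x)
          + (\<Sum>k. ennreal (t k) * (F x * indicator (cube z (2 ^ k * h)) x))"
        using W[OF h, of z]
      proof eventually_elim
        case (elim x)
        let ?S = "\<lambda>k. ennreal (t k) * indicator (cube z (2 ^ k * h)) x"
        have "F x * maximal_weight w s (cube z h) x
            \<le> F x * (ennreal (B * w x) * indicator (cube z (2 * h)) x + (\<Sum>k. ?S k))"
          using elim by (intro mult_left_mono) (simp_all add: t_def a_def)
        also have "\<dots> = F x * (ennreal (B * w x) * indicator (cube z (2 * h)) x) + (\<Sum>k. F x * ?S k)"
          by (simp add: distrib_left)
        also have "ennreal (B * w x) = ennreal B * ennreal (w x)"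
          using BD w_nonneg by (intro ennreal_mult) auto
        finally show ?case
          by (simp only: mult_ac power_one_right)
      qed
    qed
    also have "\<dots> = ennreal B * (\<integral>\<^sup>+x\<in>cube z (2 ^ 1 * h). (F x * ennreal (w x)) \<partial>lebesgue)
        + (\<Sum>k. ennreal (t k) * (\<integral>\<^sup>+x\<in>cube z (2 ^ k * h). F x \<partial>lebesgue))"
    proof -
      have 1: "(\<integral>\<^sup>+x. ennreal (t k) * (F x * indicator (cube z (2 ^ k * h)) x) \<partial>lebesgue)
          = ennreal (t k) * (\<integral>\<^sup>+x\<in>cube z (2 ^ k * h). F x \<partial>lebesgue)" for k
        by (rule nn_integral_cmult) measurable
      have 2: "(\<integral>\<^sup>+x. (\<Sum>k. ennreal (t k) * (F x * indicator (cube z (2 ^ k * h)) x)) \<partial>lebesgue)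
          = (\<Sum>k. ennreal (t k) * (\<integral>\<^sup>+x\<in>cube z (2 ^ k * h). F x \<partial>lebesgue))"
        unfolding 1[symmetric] by (rule nn_integral_suminf) measurable
      have 3: "(\<integral>\<^sup>+x. ennreal B * (F x * ennreal (w x) * indicator (cube z (2 ^ 1 * h)) x) \<partial>lebesgue)
          = ennreal B * (\<integral>\<^sup>+x\<in>cube z (2 ^ 1 * h). (F x * ennreal (w x)) \<partial>lebesgue)"
        by (rule nn_integral_cmult) measurable
      show ?thesis
        unfolding 2[symmetric] 3[symmetric] by (rule nn_integral_add) measurable
    qed
    also have "\<dots> \<le> ennreal B * ennreal (g powr p * M 1)
        + (\<Sum>k. ennreal (t k) * ennreal (c / a k * (g powr p * M k)))"
      by (intro add_mono mult_left_mono J J' suminf_le) auto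
    also have "\<dots> \<le> ennreal (B * (g powr p * (2 powr (CARD('n) / s) * c * C * M 0)))
        + (\<Sum>k. ennreal (D * c * C * g powr p * M 0 * \<gamma> ^ k))"
    proof (intro add_mono suminf_le)
      show "ennreal B * ennreal (g powr p * M 1)
          \<le> ennreal (B * (g powr p * (2 powr (CARD('n) / s) * c * C * M 0)))"
        using BD \<open>M 1 \<le> _\<close> by (subst ennreal_mult[symmetric]) (auto simp: M_def intro!: ennreal_leI mult_left_mono)
      fix k
      have "t k * (c / a k * (g powr p * M k))
          = D * c * g powr p * (2 powr - (real k * (CARD('n) / s)) * (a 0 / a k) * M k)"
        by (simp add: t_def)
      also have "\<dots> \<le> D * c * g powr p * (C * \<gamma> ^ k * M 0)"
        using BD c by (intro mult_left_mono M) auto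
      also have "\<dots> = D * c * C * g powr p * M 0 * \<gamma> ^ k"
        by simp
      finally show "ennreal (t k) * ennreal (c / a k * (g powr p * M k)) \<le> ennreal (D * c * C * g powr p * M 0 * \<gamma> ^ k)"
        using t[of k] by (subst ennreal_mult'[symmetric]) (auto intro: ennreal_leI)
    qed auto
    also have "(\<Sum>k. ennreal (D * c * C * g powr p * M 0 * \<gamma> ^ k)) = ennreal (D * c * C * g powr p * M 0 * (1 / (1 - \<gamma>)))"
      using \<gamma> BD c C by (intro suminf_ennreal_eq sums_mult geometric_sums) (auto simp: M_def)
    also have "ennreal (B * (g powr p * (2 powr (CARD('n) / s) * c * C * M 0))) + \<dots>
        = ennreal (A * M 0 * g powr p)"
      proof -
      have "B * (g powr p * (2 powr (CARD('n) / s) * c * C * M 0)) + D * c * C * g powr p * M 0 * (1 / (1 - \<gamma>))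
          = A * M 0 * g powr p"
        by (simp only: A_def distrib_left distrib_right mult_ac)
      then show ?thesis
        using \<gamma> BD c C by (subst ennreal_plus[symmetric]) (simp_all add: M_def)
    qed
    also have "A * M 0 * g powr p = (A powr (1 / p) * m (cube z h) powr e * g) powr (1 / (1 / p))"
      using A p g m[OF h, of z] by (simp add: M_def powr_mult powr_powr) (simp add: mult.commute)
    finally show ?thesis
      using p g unfolding Lp_norm_def F_def by (subst ennreal_powr_le_iff) auto
  qed
  show ?thesis
  proof (intro exI allI impI)
    fix Q :: "(real ^ 'n) set" assume "is_cube Q"
    then obtain z h where h: "0 < h" "Q = cube z h"
      by (auto simp: is_cube_iff)
    have le: "Lp_norm p (maximal_weight w s Q) UNIV f
        \<le> ennreal (A powr (1 / p) * m Q powr e) * gen_Morrey_norm m e p w f"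
      if "f \<in> fspace (gen_Morrey_norm m e p w)" for f
    proof -
      obtain g where "gen_Morrey_norm m e p w f = ennreal g" "0 \<le> g"
        using \<open>f \<in> fspace _\<close> by (cases "gen_Morrey_norm m e p w f") (auto simp: fspace_def)
      then show ?thesis
        using main[OF h(1), of f g z] \<open>f \<in> fspace _\<close> h by (simp add: fspace_def ennreal_mult)
    qed
    moreover have "fspace (gen_Morrey_norm m e p w) \<subseteq> fspace (Lp_norm p (maximal_weight w s Q) UNIV)"
      proof (intro subsetI)
      fix f assume f: "f \<in> fspace (gen_Morrey_norm m e p w)"
      have "ennreal (A powr (1 / p) * m Q powr e) * gen_Morrey_norm m e p w f < \<infinity>"
        using f by (simp add: fspace_def ennreal_mult_less_top)
      with le[OF f] have "Lp_norm p (maximal_weight w s Q) UNIV f < \<infinity>"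
        by (rule le_less_trans)
      with f show "f \<in> fspace (Lp_norm p (maximal_weight w s Q) UNIV)"
        by (simp add: fspace_def)
    qed
    ultimately show "embeds_with (A powr (1 / p) * m Q powr e) (gen_Morrey_norm m e p w)
        (Lp_norm p (maximal_weight w s Q) UNIV)"
      by (auto simp: embeds_with_def)
  qed
qed

section \<open>Choice of exponents for the two Morrey scales\<close>

lemma wmeasure_cube: "0 < h \<Longrightarrow> wmeasure w (cube z h) = cube_avg w z h * (2 * h) ^ CARD('n)"
  by (simp add: cube_avg_def)

text \<open>Collects all powers of two into one geometric ratio. Here \<open>t\<close> is the
  exponent of the volume and \<open>u\<close> that of the ratio of averages; the embedding requires
  the collected exponent to be negative.\<close>

lemma avg_ratio_decay:
  fixes \<delta> C t u s :: real
  assumes decay: "\<And>z h k. 0 < h \<Longrightarrow>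
      cube_avg w z h \<le> C * 2 powr (real k * (real CARD('n) * (1 - \<delta>) / \<sigma>)) * cube_avg w z (2 ^ k * h)"
    and "0 < C" "0 < h" "0 \<le> u"
  shows "2 powr - (real k * (real CARD('n) / s)) * 2 powr (real k * real CARD('n) * t)
      * (cube_avg w z h / cube_avg w z (2 ^ k * h)) powr u
    \<le> C powr u * (2 powr (real CARD('n) * (t + u * (1 - \<delta>) / \<sigma> - 1 / s))) ^ k"
proof -
  have a: "0 < cube_avg w z h" "0 < cube_avg w z (2 ^ k * h)"
    using assms by (auto intro!: avg_pos)
  let ?q = "real k * (real CARD('n) * (1 - \<delta>) / \<sigma>)"
  have "cube_avg w z h / cube_avg w z (2 ^ k * h) \<le> C * 2 powr ?q"
    using decay[OF \<open>0 < h\<close>, of z k] a by (simp add: field_simps)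
  then have "(cube_avg w z h / cube_avg w z (2 ^ k * h)) powr u \<le> (C * 2 powr ?q) powr u"
    using assms a by (intro powr_mono2) auto
  then have "2 powr - (real k * (real CARD('n) / s)) * 2 powr (real k * real CARD('n) * t)
      * (cube_avg w z h / cube_avg w z (2 ^ k * h)) powr u
    \<le> 2 powr - (real k * (real CARD('n) / s)) * 2 powr (real k * real CARD('n) * t) * (C * 2 powr ?q) powr u"
    by (intro mult_left_mono) auto
  also have "(C * 2 powr ?q) powr u = C powr u * 2 powr (?q * u)"
    using assms by (simp add: powr_mult powr_powr)
  also have "2 powr - (real k * (real CARD('n) / s)) * 2 powr (real k * real CARD('n) * t) * (C powr u * 2 powr (?q * u))
      = C powr u * 2 powr (- (real k * (real CARD('n) / s)) + real k * real CARD('n) * t + ?q * u)"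
    unfolding powr_add by simp
  also have "- (real k * (real CARD('n) / s)) + real k * real CARD('n) * t + ?q * u
      = real k * (real CARD('n) * (t + u * (1 - \<delta>) / \<sigma> - 1 / s))"
    using \<sigma> by (simp add: algebra_simps diff_divide_distrib)
  also have "2 powr (real k * (real CARD('n) * (t + u * (1 - \<delta>) / \<sigma> - 1 / s)))
      = (2 powr (real CARD('n) * (t + u * (1 - \<delta>) / \<sigma> - 1 / s))) ^ k"
    by (simp only: powr_power)
  finally show ?thesis .
qed

text \<open>With \<open>u = - p * r / n\<close> the collected exponent is \<open>n\<close> times
  \<open>1 - u * (1 - 1 / \<sigma>) - u * \<delta> / \<sigma> - 1 / s\<close>. The assumption on
  \<open>r\<close> bounds the bracket by \<open>1 / \<nu> - 1 / s - u * \<delta> / \<sigma>\<close>,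
  which is negative for \<open>s\<close> close to \<open>\<nu>\<close>, even if that assumption
  holds with equality.\<close>

theorem Morrey_embedding:
  assumes p: "0 < p" and \<nu>: "1 \<le> \<nu>" "\<nu> < \<sigma>" and r: "r < 0"
    and r_le: "p * r / real CARD('n) * (1 - 1 / \<sigma>) \<le> - (1 - 1 / \<nu>)"
  shows "\<exists>s\<^sub>0>\<nu>. s\<^sub>0 \<le> \<sigma> \<and> (\<forall>s. \<nu> < s \<and> s \<le> s\<^sub>0 \<longrightarrow> (\<exists>C. \<forall>Q. is_cube Q \<longrightarrow>
    embeds_with (C * wmeasure w Q powr (1 / p + r / real CARD('n)))
      (Morrey_norm p r w) (Lp_norm p (maximal_weight w s Q) UNIV)))"
proof -
  obtain \<delta> C where \<delta>: "0 < \<delta>" and C: "0 < C" and decay: "\<And>z h k. 0 < h \<Longrightarrow>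
      cube_avg w z h \<le> C * 2 powr (real k * (real CARD('n) * (1 - \<delta>) / \<sigma>)) * cube_avg w z (2 ^ k * h)"
    by (rule avg_decay) blast
  define e where "e = 1 / p + r / real CARD('n)"
  define u where "u = - (p * r / real CARD('n))"
  have u: "0 < u"
    using p r by (simp add: u_def field_simps mult_pos_neg)
  have pe: "p * e = 1 - u"
    using p by (simp add: e_def u_def field_simps)
  obtain s\<^sub>0 where s0: "\<nu> < s\<^sub>0" "s\<^sub>0 \<le> \<sigma>" "\<And>s. \<nu> < s \<Longrightarrow> s \<le> s\<^sub>0 \<Longrightarrow> 1 / \<nu> - 1 / s < u * \<delta> / \<sigma>"
    using \<nu> u \<delta> by (rule_tac ex_exponent_near[of \<nu> \<sigma> "u * \<delta> / \<sigma>"]) auto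
  have "\<exists>C. \<forall>Q. is_cube Q \<longrightarrow> embeds_with (C * wmeasure w Q powr e)
      (gen_Morrey_norm (wmeasure w) e p w) (Lp_norm p (maximal_weight w s Q) UNIV)"
    if s: "\<nu> < s" "s \<le> s\<^sub>0" for s
  proof (rule embedding)
    let ?\<gamma> = "2 powr (real CARD('n) * (p * e + u * (1 - \<delta>) / \<sigma> - 1 / s))"
    have "p * e + u * (1 - \<delta>) / \<sigma> = 1 - u * (1 - 1 / \<sigma>) - u * \<delta> / \<sigma>"
      unfolding pe using \<sigma> by (simp add: field_simps)
    moreover have "1 - 1 / \<nu> \<le> u * (1 - 1 / \<sigma>)"
      using r_le by (simp add: u_def)
    moreover have "X - q < 0" if "X = 1 - Y - Z" "1 - x \<le> Y" "x - q < Z" for X Y Z x q :: real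
      using that by linarith
    ultimately have "p * e + u * (1 - \<delta>) / \<sigma> - 1 / s < 0"
      using s0(3)[OF s] by blast
    then have "real CARD('n) * (p * e + u * (1 - \<delta>) / \<sigma> - 1 / s) < 0"
      by (intro mult_pos_neg) auto
    then show "?\<gamma> < 1"
      using powr_less_mono[of "real CARD('n) * (p * e + u * (1 - \<delta>) / \<sigma> - 1 / s)" 0 2] by simp
    show "0 < wmeasure w (cube z h)" if "0 < h" for z h
      unfolding wmeasure_cube[OF that] using avg_pos[OF that] cube_volume_pos[OF that] by (rule mult_pos_pos)
    fix z h and k :: nat assume h: "0 < (h::real)"
    then have hk: "0 < 2 ^ k * h"
      by simp
    define a b m where "a = cube_avg w z h" and "b = cube_avg w z (2 ^ k * h)" and "m = (2 * h) ^ CARD('n)"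
    have pos: "0 < a" "0 < b" "0 < m"
      using avg_pos[OF h] avg_pos[OF hk] cube_volume_pos[OF h] by (auto simp: a_def b_def m_def)
    have "2 powr - (real k * (CARD('n) / s)) * (a / b) * wmeasure w (cube z (2 ^ k * h)) powr (p * e)
        = 2 powr - (real k * (CARD('n) / s)) * (a / b) * (b * (2 powr (real k * real CARD('n)) * m)) powr (p * e)"
      unfolding wmeasure_cube[OF hk] b_def m_def dilated_volume ..
    also have "\<dots> = 2 powr - (real k * (CARD('n) / s)) * 2 powr (real k * real CARD('n) * (p * e))
        * ((a / b) * b powr (p * e)) * m powr (p * e)"
      using pos by (simp add: powr_mult powr_powr)
    \<comment> \<open>As \<open>p * e = 1 - u\<close>, the weighted measure of the dilated cube
      absorbs the power \<open>1 - u\<close> of the ratio of averages, and only the power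
      \<open>u\<close> remains to be estimated.\<close>
    also have "(a / b) * b powr (p * e) = (a / b) powr u * a powr (p * e)"
    proof -
      have "(a / b) powr u * (a / b) powr (p * e) = a / b"
        using pos by (simp add: powr_add[symmetric] pe)
      moreover have "(a / b) powr (p * e) * b powr (p * e) = a powr (p * e)"
        using pos by (simp add: powr_mult[symmetric])
      ultimately show ?thesis
        by (metis mult.assoc)
    qed
    also have "2 powr - (real k * (CARD('n) / s)) * 2 powr (real k * real CARD('n) * (p * e))
        * ((a / b) powr u * a powr (p * e)) * m powr (p * e)
      = 2 powr - (real k * (CARD('n) / s)) * 2 powr (real k * real CARD('n) * (p * e)) * (a / b) powr u
        * (a * m) powr (p * e)"
      using pos by (simp add: powr_mult)
    also have "\<dots> \<le> C powr u * ?\<gamma> ^ k * (a * m) powr (p * e)"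
      unfolding a_def b_def using C h u
      by (intro mult_right_mono avg_ratio_decay[OF decay]) auto
    finally show "2 powr - (real k * (CARD('n) / s)) * (cube_avg w z h / cube_avg w z (2 ^ k * h))
        * wmeasure w (cube z (2 ^ k * h)) powr (p * e) \<le> C powr u * ?\<gamma> ^ k * wmeasure w (cube z h) powr (p * e)"
      unfolding wmeasure_cube[OF h] a_def b_def m_def .
  qed (use p \<nu> s s0 in auto)
  then show ?thesis
    using s0(1,2) unfolding Morrey_norm_eq_gen e_def by blast
qed

text \<open>Lebesgue measure absorbs no power of the ratio of averages, so
  \<open>avg_ratio_decay\<close> is applied with \<open>u = 1\<close>. The collected exponent is at
  most \<open>n\<close> times \<open>1 / \<nu> - 1 / s - \<delta> / \<sigma>\<close>, again negative
  for \<open>s\<close> close to \<open>\<nu>\<close>.\<close>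

theorem Morrey_lambda_embedding:
  assumes p: "0 < p" and \<nu>: "1 \<le> \<nu>" "\<nu> < \<sigma>"
    and r_le: "1 + p * r / real CARD('n) \<le> 1 / \<nu> - 1 / \<sigma>"
  shows "\<exists>s\<^sub>0>\<nu>. s\<^sub>0 \<le> \<sigma> \<and> (\<forall>s. \<nu> < s \<and> s \<le> s\<^sub>0 \<longrightarrow> (\<exists>C. \<forall>Q. is_cube Q \<longrightarrow>
    embeds_with (C * measure lebesgue Q powr (1 / p + r / real CARD('n)))
      (Morrey_lambda_norm p r w) (Lp_norm p (maximal_weight w s Q) UNIV)))"
proof -
  obtain \<delta> C where \<delta>: "0 < \<delta>" and C: "0 < C" and decay: "\<And>z h k. 0 < h \<Longrightarrow>
      cube_avg w z h \<le> C * 2 powr (real k * (real CARD('n) * (1 - \<delta>) / \<sigma>)) * cube_avg w z (2 ^ k * h)"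
    by (rule avg_decay) blast
  define e where "e = 1 / p + r / real CARD('n)"
  have pe: "p * e \<le> 1 / \<nu> - 1 / \<sigma>"
    using r_le p by (simp add: e_def distrib_left)
  obtain s\<^sub>0 where s0: "\<nu> < s\<^sub>0" "s\<^sub>0 \<le> \<sigma>" "\<And>s. \<nu> < s \<Longrightarrow> s \<le> s\<^sub>0 \<Longrightarrow> 1 / \<nu> - 1 / s < \<delta> / \<sigma>"
    using \<nu> \<delta> by (rule_tac ex_exponent_near[of \<nu> \<sigma> "\<delta> / \<sigma>"]) auto
  have "\<exists>C. \<forall>Q. is_cube Q \<longrightarrow> embeds_with (C * measure lebesgue Q powr e)
      (gen_Morrey_norm (measure lebesgue) e p w) (Lp_norm p (maximal_weight w s Q) UNIV)"
    if s: "\<nu> < s" "s \<le> s\<^sub>0" for s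
  proof (rule embedding)
    let ?\<gamma> = "2 powr (real CARD('n) * (p * e + 1 * (1 - \<delta>) / \<sigma> - 1 / s))"
    have "p * e + 1 * (1 - \<delta>) / \<sigma> - 1 / s < 0"
      using s0(3)[OF s] pe by (simp add: diff_divide_distrib)
    then have "real CARD('n) * (p * e + 1 * (1 - \<delta>) / \<sigma> - 1 / s) < 0"
      by (intro mult_pos_neg) auto
    then show "?\<gamma> < 1"
      using powr_less_mono[of "real CARD('n) * (p * e + 1 * (1 - \<delta>) / \<sigma> - 1 / s)" 0 2] by simp
    show "0 < measure lebesgue (cube z h)" if "0 < h" for z :: "real ^ 'n" and h
      unfolding measure_cube[OF that] using that by (rule cube_volume_pos)
    fix z :: "real ^ 'n" and h and k :: nat assume h: "0 < (h::real)"
    then have hk: "0 < 2 ^ k * h"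
      by simp
    define a b m where "a = cube_avg w z h" and "b = cube_avg w z (2 ^ k * h)" and "m = (2 * h) ^ CARD('n)"
    have pos: "0 < a" "0 < b" "0 < m"
      using avg_pos[OF h] avg_pos[OF hk] cube_volume_pos[OF h] by (auto simp: a_def b_def m_def)
    have "2 powr - (real k * (CARD('n) / s)) * (a / b) * measure lebesgue (cube z (2 ^ k * h)) powr (p * e)
        = 2 powr - (real k * (CARD('n) / s)) * (a / b) * (2 powr (real k * real CARD('n)) * m) powr (p * e)"
      unfolding measure_cube[OF hk] m_def dilated_volume ..
    also have "\<dots> = 2 powr - (real k * (CARD('n) / s)) * 2 powr (real k * real CARD('n) * (p * e)) * (a / b) powr 1
        * m powr (p * e)"
      using pos by (simp add: powr_mult powr_powr)
    also have "\<dots> \<le> C powr 1 * ?\<gamma> ^ k * m powr (p * e)"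
      unfolding a_def b_def using C h
      by (intro mult_right_mono avg_ratio_decay[OF decay]) auto
    finally show "2 powr - (real k * (CARD('n) / s)) * (cube_avg w z h / cube_avg w z (2 ^ k * h))
        * measure lebesgue (cube z (2 ^ k * h)) powr (p * e) \<le> C powr 1 * ?\<gamma> ^ k * measure lebesgue (cube z h) powr (p * e)"
      unfolding measure_cube[OF h] a_def b_def m_def .
  qed (use p \<nu> s s0 in auto)
  then show ?thesis
    using s0(1,2) unfolding Morrey_lambda_norm_eq_gen e_def by blast
qed

section \<open>Comparison with power weights\<close>

text \<open>The maximal function is tested on the cube about the origin with half side
  \<open>1 + norm x\<close>, which contains both \<open>x\<close> and \<open>cube 0 1\<close>; the
  mass of \<open>w powr s\<close> on the latter is bounded below by
  \<open>avg_powr_le\<close>.\<close>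

lemma maximal_weight_ge:
  assumes "0 < s" "s \<le> \<sigma>"
  shows "ennreal (cube_avg w 0 1 / c * (1 + norm x) powr - (real CARD('n) / s))
    \<le> maximal_weight w s (cube 0 1) x"
proof -
  let ?a = "cube_avg w 0 1" and ?R = "1 + norm x"
  have a: "0 < ?a"
    by (intro avg_pos) simp
  have R: "0 < ?R"
    by (simp add: add_pos_nonneg)
  have "x \<in> cube 0 ?R"
    by (auto simp: mem_cube intro: order_trans[OF component_le_norm_cart])
  have "ennreal ((?a / c) powr s / ?R ^ CARD('n))
      = ennreal ((?a / c) powr s * (2 * 1) ^ CARD('n)) / ennreal ((2 * ?R) ^ CARD('n))"
    using a c R by (subst divide_ennreal) (auto simp only: power_mult_distrib intro!: mult_pos_pos, simp_all)
  also have "\<dots> \<le> (\<integral>\<^sup>+y\<in>cube 0 1. ennreal (w y powr s) \<partial>lebesgue) / ennreal ((2 * ?R) ^ CARD('n))"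
    using assms by (intro divide_right_mono_ennreal avg_powr_le) auto
  also have "\<dots> = (\<integral>\<^sup>+y\<in>cube 0 ?R. ennreal \<bar>w y powr s * indicator (cube 0 1) y\<bar> \<partial>lebesgue)
      / emeasure lebesgue (cube 0 ?R :: (real ^ 'n) set)"
    unfolding emeasure_cube[OF R] using cube_mono[of 1 ?R "0 :: real ^ 'n"]
    by (intro arg_cong2[where f = "(/)"] nn_integral_cong) (auto simp: indicator_def)
  also have "\<dots> \<le> maximal_op (\<lambda>y. w y powr s * indicator (cube 0 1) y) x"
    unfolding maximal_op_def using \<open>x \<in> cube 0 ?R\<close> is_cube_cube[OF R] by (intro SUP_upper) auto
  finally have "ennreal_powr (ennreal ((?a / c) powr s / ?R ^ CARD('n))) (1 / s)
      \<le> maximal_weight w s (cube 0 1) x"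
    unfolding maximal_weight_def using assms by (intro ennreal_powr_mono) auto
  moreover have "((?a / c) powr s / ?R ^ CARD('n)) powr (1 / s) = ?a / c * ?R powr - (real CARD('n) / s)"
  proof -
    have "((?a / c) powr s / ?R ^ CARD('n)) powr (1 / s)
        = ((?a / c) powr s) powr (1 / s) / (?R powr real CARD('n)) powr (1 / s)"
      unfolding powr_realpow[OF R] by (rule powr_divide)
    also have "\<dots> = ?a / c / ?R powr (real CARD('n) / s)"
      using a c assms by (simp add: powr_powr)
    finally show ?thesis
      by (simp add: powr_minus_divide)
  qed
  ultimately show ?thesis
    using R by (subst (asm) ennreal_powr_ennreal) auto
qed

text \<open>The power weight is pointwise at most \<open>1 / b\<close> times the maximal weight of
  \<open>cube 0 1\<close>, so its exponent is \<open>n / s\<close>.\<close>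

lemma embeds_power_weight:
  assumes p: "0 < p" and s: "0 < s" "s \<le> \<sigma>"
    and emb: "embeds_with K N (Lp_norm p (maximal_weight w s (cube 0 1)) UNIV)"
  shows "embeds N (Lp_norm p (\<lambda>x. ennreal ((1 + norm x) powr - (real CARD('n) / s))) UNIV)"
proof -
  let ?P = "\<lambda>x. (1 + norm x) powr - (real CARD('n) / s)"
  define b where "b = cube_avg w 0 1 / c"
  have b: "0 < b"
    unfolding b_def using c avg_pos[of 1 0] by simp
  \<comment> \<open>\<open>K\<close> may be negative, but \<open>ennreal\<close> truncates it to 0;
    \<open>L\<close> is the same constant made nonnegative.\<close>
  define L where "L = max K 0"
  have le: "Lp_norm p (\<lambda>x. ennreal (?P x)) UNIV f \<le> ennreal ((1 / b) powr (1 / p) * L) * N f"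
    if f: "f \<in> fspace N" for f
  proof -
    obtain g where g: "N f = ennreal g" "0 \<le> g"
      using f by (cases "N f") (auto simp: fspace_def)
    define F where "F x = ennreal (cmod (f x) powr p)" for x
    have [measurable]: "f \<in> borel_measurable lebesgue"
      using f by (simp add: fspace_def)
    have [measurable]: "(\<lambda>x::real^'n. ?P x) \<in> borel_measurable lebesgue"
      by (intro measurable_completion) measurable
    have [measurable]: "F \<in> borel_measurable lebesgue"
      unfolding F_def by measurable
    have "ennreal K = ennreal L"
      by (auto simp: L_def max_def ennreal_neg)
    then have "Lp_norm p (maximal_weight w s (cube 0 1)) UNIV f \<le> ennreal (L * g)"
      using emb f g by (auto simp: embeds_with_def ennreal_mult L_def)
    then have J: "(\<integral>\<^sup>+x. F x * maximal_weight w s (cube 0 1) x \<partial>lebesgue) \<le> ennreal ((L * g) powr p)"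
      using p g unfolding Lp_norm_def F_def by (subst (asm) ennreal_powr_le_iff) (auto simp: L_def)
    have "ennreal b * (\<integral>\<^sup>+x. F x * ennreal (?P x) \<partial>lebesgue)
        = (\<integral>\<^sup>+x. ennreal b * (F x * ennreal (?P x)) \<partial>lebesgue)"
      by (intro nn_integral_cmult[symmetric]) measurable
    also have "\<dots> \<le> (\<integral>\<^sup>+x. F x * maximal_weight w s (cube 0 1) x \<partial>lebesgue)"
    proof (rule nn_integral_mono)
      fix x
      have "ennreal b * (F x * ennreal (?P x)) = F x * ennreal (b * ?P x)"
        using b by (simp add: ennreal_mult mult_ac)
      also have "\<dots> \<le> F x * maximal_weight w s (cube 0 1) x"
        unfolding b_def by (intro mult_left_mono maximal_weight_ge s) auto
      finally show "ennreal b * (F x * ennreal (?P x)) \<le> F x * maximal_weight w s (cube 0 1) x" .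
    qed
    also note J
    finally have "ennreal (1 / b) * (ennreal b * (\<integral>\<^sup>+x. F x * ennreal (?P x) \<partial>lebesgue))
        \<le> ennreal (1 / b) * ennreal ((L * g) powr p)"
      by (rule mult_left_mono) simp
    then have "(\<integral>\<^sup>+x. F x * ennreal (?P x) \<partial>lebesgue) \<le> ennreal (1 / b) * ennreal ((L * g) powr p)"
      using b by (simp add: mult.assoc[symmetric] ennreal_mult[symmetric])
    also have "\<dots> = ennreal (((1 / b) powr (1 / p) * L * g) powr (1 / (1 / p)))"
      using b p g by (simp add: ennreal_mult[symmetric] powr_mult powr_powr L_def)
    finally have "Lp_norm p (\<lambda>x. ennreal (?P x)) UNIV f \<le> ennreal ((1 / b) powr (1 / p) * L * g)"
      using p g unfolding Lp_norm_def F_def by (subst ennreal_powr_le_iff) (auto simp: L_def)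
    then show ?thesis
      using g by (simp add: ennreal_mult L_def)
  qed
  moreover have "fspace N \<subseteq> fspace (Lp_norm p (\<lambda>x. ennreal (?P x)) UNIV)"
  proof
    fix f assume f: "f \<in> fspace N"
    have "ennreal ((1 / b) powr (1 / p) * L) * N f < \<infinity>"
      using f by (simp add: fspace_def ennreal_mult_less_top)
    with le[OF f] have "Lp_norm p (\<lambda>x. ennreal (?P x)) UNIV f < \<infinity>"
      by (rule le_less_trans)
    with f show "f \<in> fspace (Lp_norm p (\<lambda>x. ennreal (?P x)) UNIV)"
      by (simp add: fspace_def)
  qed
  ultimately show ?thesis
    unfolding embeds_def embeds_with_def by blast
qed

end

section \<open>From the weight classes to normalised constants\<close>

lemma ex_A1_reverse_Holder:
  fixes w :: "real ^ 'n \<Rightarrow> real"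
  assumes w: "w \<in> Muckenhoupt_A1 \<inter> reverse_Holder \<sigma>" and \<sigma>: "1 < \<sigma>"
  shows "\<exists>c. A1_reverse_Holder w \<sigma> c"
proof -
  have weight: "weight w" and pos: "AE x in lebesgue. 0 < w x"
    using w by (auto simp: Muckenhoupt_A1_def)
  obtain c\<^sub>1 where c1: "\<And>Q. is_cube Q \<Longrightarrow>
      AE x in lebesgue. x \<in> Q \<longrightarrow> wmeasure w Q / measure lebesgue Q \<le> c\<^sub>1 * w x"
    using w by (auto simp: Muckenhoupt_A1_def)
  obtain c\<^sub>2 where c2: "\<And>Q. is_cube Q \<Longrightarrow>
      ennreal_powr ((\<integral>\<^sup>+x\<in>Q. ennreal (w x powr \<sigma>) \<partial>lebesgue) / emeasure lebesgue Q) (1 / \<sigma>)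
        \<le> ennreal (c\<^sub>2 * (wmeasure w Q / measure lebesgue Q))"
    using w by (auto simp: reverse_Holder_def)
  \<comment> \<open>Enlarging the constant to at least 1 makes it safe to raise to the power
    \<open>\<sigma>\<close> and ensures \<open>c \<ge> 1\<close>.\<close>
  define K where "K = max 1 c\<^sub>2"
  define c where "c = max c\<^sub>1 (K powr \<sigma>)"
  have K: "1 \<le> K" and "1 \<le> K powr \<sigma>"
    using \<sigma> by (auto simp: K_def intro!: ge_one_powr_ge_zero)
  then have c: "1 \<le> c"
    by (simp add: c_def)
  have avg: "wmeasure w (cube z h) / measure lebesgue (cube z h) = cube_avg w z h" if "0 < h" for z h
    unfolding measure_cube[OF that] cube_avg_def ..
  have avg_nonneg: "0 \<le> cube_avg w z h" if "0 < h" for z h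
    unfolding cube_avg_def wmeasure_def set_lebesgue_integral_def using weight that
    by (intro divide_nonneg_nonneg integral_nonneg_AE) (auto simp: weight_def)
  have "A1_reverse_Holder w \<sigma> c"
  proof
    fix z :: "real ^ 'n" and h :: real assume h: "0 < h"
    show "AE x in lebesgue. x \<in> cube z h \<longrightarrow> cube_avg w z h \<le> c * w x"
      using c1[OF is_cube_cube[OF h], of z] unfolding avg[OF h]
    proof eventually_elim
      case (elim x)
      have "c\<^sub>1 * w x \<le> c * w x"
        using weight by (intro mult_right_mono) (auto simp: c_def weight_def)
      with elim show ?case
        by linarith
    qed
    let ?V = "\<integral>\<^sup>+x\<in>cube z h. ennreal (w x powr \<sigma>) \<partial>lebesgue"
    define m where "m = (2 * h) ^ CARD('n)"
    have m: "0 < m"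
      unfolding m_def using h by (rule cube_volume_pos)
    have "ennreal_powr (?V / ennreal m) (1 / \<sigma>) \<le> ennreal (c\<^sub>2 * cube_avg w z h)"
      using c2[OF is_cube_cube[OF h], of z] unfolding avg[OF h] emeasure_cube[OF h] m_def .
    also have "\<dots> \<le> ennreal (K * cube_avg w z h)"
      using avg_nonneg[OF h, of z] by (intro ennreal_leI mult_right_mono) (auto simp: K_def)
    finally have V: "?V / ennreal m \<le> ennreal (K powr \<sigma> * cube_avg w z h powr \<sigma>)"
      using \<sigma> K avg_nonneg[OF h, of z] by (subst (asm) ennreal_powr_le_iff) (auto simp: powr_mult)
    have "?V = ?V / ennreal m * ennreal m"
      using m by (simp add: ennreal_divide_times divide_mult_eq ennreal_times_divide)
    also have "\<dots> \<le> ennreal (K powr \<sigma> * cube_avg w z h powr \<sigma>) * ennreal m"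
      using V by (rule mult_right_mono) simp
    also have "\<dots> = ennreal (K powr \<sigma> * cube_avg w z h powr \<sigma> * m)"
      using m by (intro ennreal_mult[symmetric]) auto
    also have "\<dots> \<le> ennreal (c * cube_avg w z h powr \<sigma> * m)"
      using m by (intro ennreal_leI mult_right_mono) (auto simp: c_def)
    finally show "?V \<le> ennreal (c * cube_avg w z h powr \<sigma> * (2 * h) ^ CARD('n))"
      unfolding m_def .
  qed (fact weight pos \<sigma> c)+
  then show ?thesis ..
qed

section \<open>The embeddings in terms of conjugate exponents\<close>

theorem proposition3p4:
  fixes w :: "real ^ 'n \<Rightarrow> real" and p \<nu> \<sigma> r n \<sigma>' inv_\<nu>' :: real and cond cond_lambda :: bool
  defines "n \<equiv> real CARD('n)"
    and "\<sigma>' \<equiv> real_of_ereal (conj_exponent \<sigma>)"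
    and "inv_\<nu>' \<equiv> real_of_ereal (1 / conj_exponent \<nu>)"
    and "cond \<equiv> r \<in> {- n / p .. - n * \<sigma>' / p * inv_\<nu>'} \<and> (\<nu> = 1 \<longrightarrow> r \<noteq> 0)"
    and "cond_lambda \<equiv> r \<in> {- n / p .. - n * (1 / \<sigma> + inv_\<nu>') / p}"
  assumes "1 \<le> p" and "1 \<le> \<nu>" and "\<nu> < \<sigma>"
    and "w \<in> Muckenhoupt_A1 \<inter> reverse_Holder \<sigma>"
  shows
    "(cond \<longrightarrow> (\<exists>s\<^sub>0>\<nu>. \<forall>s. \<nu> < s \<and> s \<le> s\<^sub>0 \<longrightarrow>
        (\<exists>C. \<forall>Q. is_cube Q \<longrightarrow>
          embeds_with (C * wmeasure w Q powr (1 / p + r / n))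
            (Morrey_norm p r w) (Lp_norm p (maximal_weight w s Q) UNIV)))) \<and>
     (cond_lambda \<longrightarrow> (\<exists>s\<^sub>0>\<nu>. \<forall>s. \<nu> < s \<and> s \<le> s\<^sub>0 \<longrightarrow>
        (\<exists>C. \<forall>Q. is_cube Q \<longrightarrow>
          embeds_with (C * measure lebesgue Q powr (1 / p + r / n))
            (Morrey_lambda_norm p r w) (Lp_norm p (maximal_weight w s Q) UNIV)))) \<and>
     (\<exists>\<alpha>. 0 < \<alpha> \<and> \<alpha> < n / \<nu> \<and>
        (cond \<longrightarrow> embeds (Morrey_norm p r w)
           (Lp_norm p (\<lambda>x. ennreal ((1 + norm x) powr - \<alpha>)) UNIV)) \<and>
        (cond_lambda \<longrightarrow> embeds (Morrey_lambda_norm p r w)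
           (Lp_norm p (\<lambda>x. ennreal ((1 + norm x) powr - \<alpha>)) UNIV)))"
proof -
  have \<sigma>: "1 < \<sigma>" and p: "0 < p" and \<nu>: "0 < \<nu>"
    using assms(6-8) by auto
  have n: "0 < n"
    by (simp add: n_def)
  have \<sigma>': "\<sigma>' = \<sigma> / (\<sigma> - 1)"
    using \<sigma> by (simp add: \<sigma>'_def conj_exponent_def)
  have \<nu>': "inv_\<nu>' = 1 - 1 / \<nu>"
    using \<open>1 \<le> \<nu>\<close> by (auto simp: inv_\<nu>'_def conj_exponent_def one_ereal_def field_simps)
  obtain c where "A1_reverse_Holder w \<sigma> c"
    using ex_A1_reverse_Holder[OF assms(9) \<sigma>] by blast
  then interpret A1_reverse_Holder w \<sigma> c .
  let ?emb = "\<lambda>s. \<exists>C. \<forall>Q. is_cube Q \<longrightarrow> embeds_with (C * wmeasure w Q powr (1 / p + r / n))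
    (Morrey_norm p r w) (Lp_norm p (maximal_weight w s Q) UNIV)"
  let ?emb_lambda = "\<lambda>s. \<exists>C. \<forall>Q. is_cube Q \<longrightarrow> embeds_with (C * measure lebesgue Q powr (1 / p + r / n))
    (Morrey_lambda_norm p r w) (Lp_norm p (maximal_weight w s Q) UNIV)"
  have "\<exists>s\<^sub>0>\<nu>. s\<^sub>0 \<le> \<sigma> \<and> (\<forall>s. \<nu> < s \<and> s \<le> s\<^sub>0 \<longrightarrow> ?emb s)" if cond
  proof -
    have r: "r \<le> - n * \<sigma>' / p * inv_\<nu>'" "\<nu> = 1 \<longrightarrow> r \<noteq> 0"
      using that by (auto simp: cond_def)
    have "p * r / n \<le> - \<sigma>' * inv_\<nu>'"
      using r(1) p n by (simp add: field_simps)
    then have "p * r / n * (1 - 1 / \<sigma>) \<le> - \<sigma>' * inv_\<nu>' * (1 - 1 / \<sigma>)"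
      using \<sigma> by (intro mult_right_mono) auto
    \<comment> \<open>Here \<open>\<sigma>' * (1 - 1 / \<sigma>) = 1\<close>.\<close>
    also have "\<dots> = - (1 - 1 / \<nu>)"
      using \<sigma> by (simp add: \<sigma>' \<nu>' divide_simps)
    finally have *: "p * r / n * (1 - 1 / \<sigma>) \<le> - (1 - 1 / \<nu>)" .
    \<comment> \<open>For \<open>\<nu> = 1\<close> the upper bound on \<open>r\<close> is 0 and the
      endpoint is excluded by assumption; otherwise the upper bound itself is negative.\<close>
    have "r < 0"
    proof (cases "\<nu> = 1")
      case True
      then show ?thesis
        using r \<nu>' by simp
    next
      case False
      then have "0 < n * \<sigma>' / p * inv_\<nu>'"
        using n p \<sigma> \<open>1 \<le> \<nu>\<close> unfolding \<sigma>' \<nu>' by (intro mult_pos_pos divide_pos_pos) auto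
      then show ?thesis
        using r(1) by simp
    qed
    then show ?thesis
      using Morrey_embedding[OF p \<open>1 \<le> \<nu>\<close> \<open>\<nu> < \<sigma>\<close>] * unfolding n_def by blast
  qed
  \<comment> \<open>If \<open>cond\<close> fails, \<open>\<sigma>\<close> itself serves as
    threshold. A threshold is thus available in every case, as the choice of a common
    \<open>s\<close> below requires.\<close>
  then obtain s\<^sub>1 where s1: "\<nu> < s\<^sub>1" "s\<^sub>1 \<le> \<sigma>" "\<And>s. cond \<Longrightarrow> \<nu> < s \<Longrightarrow> s \<le> s\<^sub>1 \<Longrightarrow> ?emb s"
    using \<open>\<nu> < \<sigma>\<close> by (cases cond) (blast, blast)
  have "\<exists>s\<^sub>0>\<nu>. s\<^sub>0 \<le> \<sigma> \<and> (\<forall>s. \<nu> < s \<and> s \<le> s\<^sub>0 \<longrightarrow> ?emb_lambda s)" if cond_lambda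
  proof -
    have "r \<le> - n * (1 / \<sigma> + inv_\<nu>') / p"
      using that by (auto simp: cond_lambda_def)
    then have "r * (p / n) \<le> - n * (1 / \<sigma> + inv_\<nu>') / p * (p / n)"
      using p n by (intro mult_right_mono) auto
    also have "\<dots> = - (1 / \<sigma> + inv_\<nu>')"
      using p n by simp
    finally have "1 + p * r / n \<le> 1 / \<nu> - 1 / \<sigma>"
      by (simp add: \<nu>' mult.commute)
    then show ?thesis
      using Morrey_lambda_embedding[OF p \<open>1 \<le> \<nu>\<close> \<open>\<nu> < \<sigma>\<close>] unfolding n_def by blast
  qed
  then obtain s\<^sub>2 where s2: "\<nu> < s\<^sub>2" "s\<^sub>2 \<le> \<sigma>" "\<And>s. cond_lambda \<Longrightarrow> \<nu> < s \<Longrightarrow> s \<le> s\<^sub>2 \<Longrightarrow> ?emb_lambda s"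
    using \<open>\<nu> < \<sigma>\<close> by (cases cond_lambda) (blast, blast)
  \<comment> \<open>One \<open>s\<close> below both thresholds gives the same exponent
    \<open>n / s\<close> for both spaces; it is less than \<open>n / \<nu>\<close> because
    \<open>s > \<nu>\<close>.\<close>
  define s where "s = min s\<^sub>1 s\<^sub>2"
  have s: "\<nu> < s" "s \<le> s\<^sub>1" "s \<le> s\<^sub>2" "0 < s" "s \<le> \<sigma>"
    using s1(1,2) s2(1) \<nu> by (auto simp: s_def)
  have "is_cube (cube (0 :: real ^ 'n) 1)"
    by (rule is_cube_cube) simp
  then have "cond \<longrightarrow> embeds (Morrey_norm p r w) (Lp_norm p (\<lambda>x. ennreal ((1 + norm x) powr - (n / s))) UNIV)"
    and "cond_lambda \<longrightarrow> embeds (Morrey_lambda_norm p r w) (Lp_norm p (\<lambda>x. ennreal ((1 + norm x) powr - (n / s))) UNIV)"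
    using s1(3)[OF _ s(1,2)] s2(3)[OF _ s(1,3)] embeds_power_weight[OF p s(4,5)]
    unfolding n_def by blast+
  moreover have "0 < n / s" "n / s < n / \<nu>"
    using n s \<nu> by (auto intro: divide_strict_left_mono)
  ultimately show ?thesis
    using s1(1,3) s2(1,3) by blast
qed

end
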